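(* Let $\hat\chi,\hat\xi\in\hat N^+_{\mathbb R}$ be two Reeb vectors, let $r_0$ be a radius function for $\hat\chi$ with $S=\{r_0=1\}$, and let $r=r_0^{\hat\xi}$ be the deformation of $r_0$ with respect to $\hat\xi$, i.e. the unique radius function for $\hat\xi$ with $\{r=1\}=S$. Put $\eta_0=-Jd\log r_0$, $\eta=-Jd\log r$. Let $g$ be a positive function on $P_{\hat\xi}$ and define the positive function $g_0$ on $P_{\hat\chi}$ by $g_0(\hat y)=\langle\hat y,\hat\xi\rangle^{-n-2}g\big(\hat y/\langle\hat y,\hat\xi\rangle\big)$. Then $\eta$ satisfies $$g(\eta)(d\eta)^n\wedge\eta=dV_S^{\hat\xi}\quad\text{on }S$$ if and only if $\eta_0$ satisfies $$g_0(\eta_0)(d\eta_0)^n\wedge\eta_0=dV_S^{\hat\chi}\quad\text{on }S.$$ In particular, $\eta$ satisfies $(d\eta)^n\wedge\eta=dV^{\hat\xi}_S$ (the equation for $r$ to be the radius function of a Ricci-flat Kähler cone metric) if and only if $\eta_0(\hat\xi)^{-n-2}(d\eta_0)^n\wedge\eta_0=dV_S^{\hat\chi}$.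
   Context: $Y=\mathrm{Spec}(R)$ is a normal affine variety of dimension $n+1$ with isolated singularity $o$ and an effective action of $\hat{\mathbb T}\cong(\mathbb C^* )^{r+1}$ with $o$ as only fixed point; $\hat T$ is the compact torus, $\hat N_{\mathbb R}=\mathrm{Lie}(\hat T)$, $R=\bigoplus_{\hat\alpha}R_{\hat\alpha}$ the weight decomposition, and the Reeb cone is $\hat N_{\mathbb R}^+=\{\hat\xi\in\hat N_{\mathbb R}:\langle\hat\alpha,\hat\xi\rangle>0\ \forall\,\hat\alpha\neq0\text{ with }R_{\hat\alpha}\ne0\}$. Elements of $\hat N_{\mathbb R}$ are identified with real holomorphic vector fields on $Y^*=Y\setminus\{o\}$, with complex structure $J$. $Y$ is $\mathbb Q$-Gorenstein, and $s$ is a $\hat{\mathbb T}$-equivariant nowhere vanishing section of $mK_Y$ for some $m$, with associated volume form $dV_Y=(\sqrt{-1}^{\,m(n+1)^2}s\wedge\bar s)^{1/m}$. A radius function for $\hat\chi\in\hat N^+_{\mathbb R}$ is a smooth positive $\hat T$-invariant function $r_0$ on $Y^*$ such that $\sqrt{-1}\partial\bar\partial r_0^2$ is Kähler, $\frac12\sqrt{-1}\partial\bar\partial r_0^2(\cdot,J\cdot)$ is a Riemannian cone metric $dr_0^2+r_0^2g_S$, and $J(r_0\partial_{r_0})=\hat\chi$. For one-forms $(J\alpha)(X)=\alpha(JX)$. At each point, a contact form $\eta$ is regarded as the element $\hat\zeta\mapsto\eta(\hat\zeta)$ of $\hat N_{\mathbb R}^*$. The moment map of $r$ is $\langle\mu_r,\hat\zeta\rangle=r^2\eta(\hat\zeta)$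 for $\hat\zeta\in\hat N_{\mathbb R}$; its image is a rational polyhedral cone $\mathcal C^*\subset\hat N_{\mathbb R}^*$ (dual to the Reeb cone), and $P_{\hat\xi}=\{\hat y\in\mathcal C^*:\langle\hat y,\hat\xi\rangle=1\}$; thus $\eta$ takes values in $P_{\hat\xi}$ and $\eta_0$ in $P_{\hat\chi}$. Finally $dV_S^{\hat\xi}=\frac12\iota_{r\partial_r}dV_Y|_S$ and $dV_S^{\hat\chi}=\frac12\iota_{r_0\partial_{r_0}}dV_Y|_S$. *)

theory Defs
  imports "HOL-Analysis.Analysis" "HOL-Combinatorics.Permutations"
begin

section \<open>Affine varieties and algebraic torus actions\<close>

inductive_set calgebra :: "('a \<Rightarrow> complex) set \<Rightarrow> ('a \<Rightarrow> complex) set"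
  for G :: "('a \<Rightarrow> complex) set" where
  const: "(\<lambda>_. c) \<in> calgebra G"
| gen: "f \<in> G \<Longrightarrow> f \<in> calgebra G"
| add: "f \<in> calgebra G \<Longrightarrow> h \<in> calgebra G \<Longrightarrow> (\<lambda>x. f x + h x) \<in> calgebra G"
| mult: "f \<in> calgebra G \<Longrightarrow> h \<in> calgebra G \<Longrightarrow> (\<lambda>x. f x * h x) \<in> calgebra G"

definition polys :: "(complex^'N \<Rightarrow> complex) set" where
  "polys = calgebra {\<lambda>y. y $ j | j. True}"

definition algebraic_set :: "(complex^'N) set \<Rightarrow> bool" where
  "algebraic_set Y \<longleftrightarrow> (\<exists>F \<subseteq> polys. Y = {y. \<forall>f\<in>F. f y = 0})"

definition affine_variety :: "(complex^'N) set \<Rightarrow> bool" where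
  "affine_variety Y \<longleftrightarrow> algebraic_set Y \<and> Y \<noteq> {} \<and>
     (\<forall>A B. algebraic_set A \<longrightarrow> algebraic_set B \<longrightarrow> Y \<subseteq> A \<union> B \<longrightarrow> Y \<subseteq> A \<or> Y \<subseteq> B)"

definition coordinate_ring :: "(complex^'N) set \<Rightarrow> (complex^'N \<Rightarrow> complex) set" where
  "coordinate_ring Y = (\<lambda>f. restrict f Y) ` polys"

text \<open>The coordinate ring is integrally closed: if the fraction \<open>a / b\<close> is a root of a monic
  polynomial of degree \<open>k\<close> over the ring (denominators cleared), then it lies in the ring.\<close>

definition normal_variety :: "(complex^'N) set \<Rightarrow> bool" where
  "normal_variety Y \<longleftrightarrow>
     (\<forall>a \<in> coordinate_ring Y. \<forall>b \<in> coordinate_ring Y. \<forall>k>0. \<forall>c.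
        (\<exists>y\<in>Y. b y \<noteq> 0) \<and> (\<forall>i<k. c i \<in> coordinate_ring Y) \<and>
        (\<forall>y\<in>Y. a y ^ k + (\<Sum>i<k. c i y * a y ^ i * b y ^ (k - i)) = 0)
        \<longrightarrow> (\<exists>q \<in> coordinate_ring Y. \<forall>y\<in>Y. a y = q y * b y))"

definition torus :: "(complex^'k) set" where
  "torus = {t. \<forall>i. t $ i \<noteq> 0}"

definition compact_torus :: "(complex^'k) set" where
  "compact_torus = {t. \<forall>i. norm (t $ i) = 1}"

definition torus_char :: "int^'k \<Rightarrow> complex^'k \<Rightarrow> complex" where
  "torus_char \<alpha> t = (\<Prod>i\<in>UNIV. (t $ i) powi (\<alpha> $ i))"

text \<open>The last clause says that the action is a morphism of varieties from the product of the
  torus and \<open>Y\<close> to \<open>Y\<close>.\<close>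

definition torus_action :: "(complex^'N) set \<Rightarrow> (complex^'k \<Rightarrow> complex^'N \<Rightarrow> complex^'N) \<Rightarrow> bool" where
  "torus_action Y act \<longleftrightarrow>
     (\<forall>t\<in>torus. \<forall>y\<in>Y. act t y \<in> Y) \<and>
     (\<forall>y\<in>Y. act 1 y = y) \<and>
     (\<forall>t\<in>torus. \<forall>t'\<in>torus. \<forall>y\<in>Y. act (t * t') y = act t (act t' y)) \<and>
     (\<forall>j. \<exists>F \<in> calgebra ({\<lambda>(t, y). t $ i | i. True} \<union> {\<lambda>(t, y). inverse (t $ i) | i. True}
                          \<union> {\<lambda>(t, y). y $ i | i. True}).
        \<forall>t\<in>torus. \<forall>y\<in>Y. act t y $ j = F (t, y))"

definition effective_action :: "(complex^'N) set \<Rightarrow> (complex^'k \<Rightarrow> complex^'N \<Rightarrow> complex^'N) \<Rightarrow> bool" where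
  "effective_action Y act \<longleftrightarrow> (\<forall>t\<in>torus. (\<forall>y\<in>Y. act t y = y) \<longrightarrow> t = 1)"

definition fixed_points :: "(complex^'N) set \<Rightarrow> (complex^'k \<Rightarrow> complex^'N \<Rightarrow> complex^'N) \<Rightarrow> (complex^'N) set" where
  "fixed_points Y act = {y\<in>Y. \<forall>t\<in>torus. act t y = y}"

definition weight_space ::
  "(complex^'N) set \<Rightarrow> (complex^'k \<Rightarrow> complex^'N \<Rightarrow> complex^'N) \<Rightarrow> int^'k \<Rightarrow> (complex^'N \<Rightarrow> complex) set" where
  "weight_space Y act \<alpha> =
     {f \<in> coordinate_ring Y. \<forall>t\<in>torus. \<forall>y\<in>Y. f (act t y) = torus_char \<alpha> t * f y}"

text \<open>The Lie algebra of the compact torus is identified with \<open>real^'k\<close>, \<open>\<zeta>\<close> generating the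
  one-parameter group \<open>s \<mapsto> (exp (\<i> s \<zeta>\<^sub>i))\<^sub>i\<close>.\<close>

definition reeb_cone :: "(complex^'N) set \<Rightarrow> (complex^'k \<Rightarrow> complex^'N \<Rightarrow> complex^'N) \<Rightarrow> (real^'k) set" where
  "reeb_cone Y act =
     {\<xi>. \<forall>\<alpha>. \<alpha> \<noteq> 0 \<longrightarrow> (\<exists>f \<in> weight_space Y act \<alpha>. \<exists>y\<in>Y. f y \<noteq> 0)
          \<longrightarrow> (\<Sum>i\<in>UNIV. of_int (\<alpha> $ i) * \<xi> $ i) > 0}"

definition torus_field :: "(complex^'k \<Rightarrow> complex^'N \<Rightarrow> complex^'N) \<Rightarrow> real^'k \<Rightarrow> complex^'N \<Rightarrow> complex^'N" where
  "torus_field act \<zeta> p =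
     vector_derivative (\<lambda>s. act (\<chi> i. exp (\<i> * of_real (s * \<zeta> $ i))) p) (at 0)"

text \<open>Elements of the dual of the Lie algebra are linear functions \<open>real^'k \<Rightarrow> real\<close>. The image of
  the moment map of any radius function (together with the origin) is the dual cone of the Reeb
  cone.\<close>

definition moment_cone :: "(complex^'N) set \<Rightarrow> (complex^'k \<Rightarrow> complex^'N \<Rightarrow> complex^'N) \<Rightarrow> (real^'k \<Rightarrow> real) set" where
  "moment_cone Y act = {y. linear y \<and> (\<forall>\<zeta> \<in> reeb_cone Y act. 0 \<le> y \<zeta>)}"

definition moment_slice ::
  "(complex^'N) set \<Rightarrow> (complex^'k \<Rightarrow> complex^'N \<Rightarrow> complex^'N) \<Rightarrow> real^'k \<Rightarrow> (real^'k \<Rightarrow> real) set" where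
  "moment_slice Y act \<xi> = {y \<in> moment_cone Y act. y \<xi> = 1}"


section \<open>Submanifolds of Euclidean space\<close>

primrec Ck_on :: "nat \<Rightarrow> 'a::real_normed_vector set \<Rightarrow> ('a \<Rightarrow> 'b::real_normed_vector) \<Rightarrow> bool" where
  "Ck_on 0 U f \<longleftrightarrow> continuous_on U f"
| "Ck_on (Suc k) U f \<longleftrightarrow>
     (\<exists>f'. (\<forall>x\<in>U. (f has_derivative f' x) (at x)) \<and> (\<forall>v. Ck_on k U (\<lambda>x. f' x v)))"

definition smooth_open :: "'a::real_normed_vector set \<Rightarrow> ('a \<Rightarrow> 'b::real_normed_vector) \<Rightarrow> bool" where
  "smooth_open U f \<longleftrightarrow> (\<forall>k. Ck_on k U f)"

definition smooth_map :: "'a::real_normed_vector set \<Rightarrow> ('a \<Rightarrow> 'b::real_normed_vector) \<Rightarrow> bool" where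
  "smooth_map M f \<longleftrightarrow>
     (\<forall>p\<in>M. \<exists>U F. open U \<and> p \<in> U \<and> smooth_open U F \<and> (\<forall>x \<in> U \<inter> M. F x = f x))"

text \<open>For an embedded submanifold \<open>M\<close>, velocities of curves differentiable at the single point \<open>0\<close>
  give the same space as velocities of smooth curves.\<close>

definition tangent_space :: "'a::real_normed_vector set \<Rightarrow> 'a \<Rightarrow> 'a set" where
  "tangent_space M p =
     {v. \<exists>\<gamma>::real \<Rightarrow> 'a. range \<gamma> \<subseteq> M \<and> \<gamma> 0 = p \<and> (\<gamma> has_vector_derivative v) (at 0)}"

text \<open>The derivative of \<open>f\<close> within \<open>M\<close> is only determined, and only ever used, on tangent vectors
  of \<open>M\<close>.\<close>

abbreviation differential ::
  "'a::real_normed_vector set \<Rightarrow> ('a \<Rightarrow> 'b::real_normed_vector) \<Rightarrow> 'a \<Rightarrow> 'a \<Rightarrow> 'b" where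
  "differential M f p \<equiv> frechet_derivative f (at p within M)"

definition holomorphic_open :: "(complex^'d) set \<Rightarrow> (complex^'d \<Rightarrow> complex) \<Rightarrow> bool" where
  "holomorphic_open U f \<longleftrightarrow> smooth_open U f \<and>
     (\<forall>x\<in>U. \<forall>c v. frechet_derivative f (at x) (c *s v) = c * frechet_derivative f (at x) v)"

text \<open>Holomorphic local parametrizations of \<open>M\<close> by open subsets of \<open>complex^'d\<close>.\<close>

definition chart :: "(complex^'N) set \<Rightarrow> (complex^'d) set \<Rightarrow> (complex^'d \<Rightarrow> complex^'N) \<Rightarrow> bool" where
  "chart M U \<phi> \<longleftrightarrow> open U \<and> smooth_open U \<phi> \<and> (\<forall>j. holomorphic_open U (\<lambda>x. \<phi> x $ j)) \<and>
     (\<forall>x\<in>U. inj (frechet_derivative \<phi> (at x))) \<and>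
     openin (top_of_set M) (\<phi> ` U) \<and> (\<exists>\<psi>. homeomorphism U (\<phi> ` U) \<phi> \<psi>)"

definition regular_locus :: "'d::finite itself \<Rightarrow> (complex^'N) set \<Rightarrow> (complex^'N) set" where
  "regular_locus D Y = {p\<in>Y. \<exists>U (\<phi>::complex^'d \<Rightarrow> complex^'N). chart Y U \<phi> \<and> p \<in> \<phi> ` U}"


section \<open>Differential forms\<close>

text \<open>The value at a point of a form of degree \<open>k\<close> is a function of sequences of vectors, of which
  only the first \<open>k\<close> matter. The parameter \<open>sc\<close> is the scalar multiplication, so that real and
  complex multilinear forms are covered; \<open>V\<close> is the (real or complex) tangent space.\<close>

definition alternating_on ::
  "('c::field \<Rightarrow> 'v::ab_group_add \<Rightarrow> 'v) \<Rightarrow> 'v set \<Rightarrow> nat \<Rightarrow> ((nat \<Rightarrow> 'v) \<Rightarrow> 'c) \<Rightarrow> bool" where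
  "alternating_on sc V k a \<longleftrightarrow>
     (\<forall>v w. (\<forall>i<k. v i = w i) \<longrightarrow> a v = a w) \<and>
     (\<forall>v. (\<forall>i<k. v i \<in> V) \<longrightarrow>
        (\<forall>i<k. \<forall>c. \<forall>x\<in>V. \<forall>y\<in>V. a (v(i := sc c x + y)) = c * a (v(i := x)) + a (v(i := y))) \<and>
        (\<forall>i<k. \<forall>j<k. i \<noteq> j \<longrightarrow> v i = v j \<longrightarrow> a v = 0))"

text \<open>Iterated wedge product of a list of forms paired with their degrees, normalized so that
  the product of one-forms is the determinant:
  \<open>(\<alpha>\<^sub>1 \<and> \<dots> \<and> \<alpha>\<^sub>m) v = (\<Sum>\<sigma>. sign \<sigma> * \<alpha>\<^sub>1 (v \<circ> \<sigma>) * \<dots>) / (k\<^sub>1! \<dots> k\<^sub>m!)\<close>, where each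
  factor takes the next block of arguments.\<close>

primrec tensor_list :: "(nat \<times> ((nat \<Rightarrow> 'v) \<Rightarrow> 'c)) list \<Rightarrow> (nat \<Rightarrow> 'v) \<Rightarrow> 'c::field_char_0" where
  "tensor_list [] v = 1"
| "tensor_list (a # as) v = snd a v * tensor_list as (\<lambda>i. v (i + fst a))"

definition wedge_list :: "(nat \<times> ((nat \<Rightarrow> 'v) \<Rightarrow> 'c)) list \<Rightarrow> (nat \<Rightarrow> 'v) \<Rightarrow> 'c::field_char_0" where
  "wedge_list as v =
     (\<Sum>\<sigma> | \<sigma> permutes {..<sum_list (map fst as)}. of_int (sign \<sigma>) * tensor_list as (v \<circ> \<sigma>))
       / prod_list (map (\<lambda>a. fact (fst a)) as)"

text \<open>Exterior derivative of a \<open>k\<close>-form \<open>\<omega>\<close> on \<open>M\<close>, computed in a local parametrization around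
  the point by \<open>d\<omega> (v\<^sub>0, \<dots>, v\<^sub>k) = (\<Sum>i. (-1)^i \<partial>\<^sub>i \<omega> (v\<^sub>0, \<dots>, omit v\<^sub>i, \<dots>, v\<^sub>k))\<close> with constant
  coordinate vector fields; the result does not depend on the chosen parametrization.\<close>

definition ext_deriv ::
  "'d::finite itself \<Rightarrow> (complex^'N) set \<Rightarrow> nat \<Rightarrow> (complex^'N \<Rightarrow> (nat \<Rightarrow> complex^'N) \<Rightarrow> real)
     \<Rightarrow> complex^'N \<Rightarrow> (nat \<Rightarrow> complex^'N) \<Rightarrow> real" where
  "ext_deriv D M k \<omega> p v =
     (let (U, \<phi>) = (SOME (U, \<phi>). chart M U (\<phi>::complex^'d \<Rightarrow> complex^'N) \<and> p \<in> \<phi> ` U);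
          x = inv_into U \<phi> p;
          a = (\<lambda>i. inv (frechet_derivative \<phi> (at x)) (v i))
      in \<Sum>i\<le>k. (-1) ^ i *
           frechet_derivative
             (\<lambda>z. \<omega> (\<phi> z) (\<lambda>j. frechet_derivative \<phi> (at z) (a (if j < i then j else Suc j))))
             (at x) (a i))"

definition smooth_form ::
  "'d::finite itself \<Rightarrow> (complex^'N) set \<Rightarrow> nat \<Rightarrow> (complex^'N \<Rightarrow> (nat \<Rightarrow> complex^'N) \<Rightarrow> real) \<Rightarrow> bool" where
  "smooth_form D M k \<omega> \<longleftrightarrow>
     (\<forall>p\<in>M. alternating_on (*\<^sub>R) (tangent_space M p) k (\<omega> p)) \<and>
     (\<forall>U (\<phi>::complex^'d \<Rightarrow> complex^'N). chart M U \<phi> \<longrightarrow>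
        (\<forall>a. smooth_open U (\<lambda>x. \<omega> (\<phi> x) (\<lambda>i. frechet_derivative \<phi> (at x) (a i)))))"

text \<open>The complex structure of a complex submanifold is multiplication by \<open>\<i>\<close>.\<close>

abbreviation cJ :: "complex^'N \<Rightarrow> complex^'N" where
  "cJ v \<equiv> \<i> *s v"

abbreviation pair :: "'v \<Rightarrow> 'v \<Rightarrow> nat \<Rightarrow> 'v" where
  "pair u w \<equiv> (\<lambda>i. if i = 0 then u else w)"

definition kahler_form ::
  "'d::finite itself \<Rightarrow> (complex^'N) set \<Rightarrow> (complex^'N \<Rightarrow> (nat \<Rightarrow> complex^'N) \<Rightarrow> real) \<Rightarrow> bool" where
  "kahler_form D M \<omega> \<longleftrightarrow> smooth_form D M 2 \<omega> \<and>
     (\<forall>p\<in>M. \<forall>v. (\<forall>i<3. v i \<in> tangent_space M p) \<longrightarrow> ext_deriv D M 2 \<omega> p v = 0) \<and>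
     (\<forall>p\<in>M. \<forall>u\<in>tangent_space M p. \<forall>w\<in>tangent_space M p.
        \<omega> p (pair (cJ u) (cJ w)) = \<omega> p (pair u w)) \<and>
     (\<forall>p\<in>M. \<forall>u\<in>tangent_space M p. u \<noteq> 0 \<longrightarrow> \<omega> p (pair u (cJ u)) > 0)"

text \<open>With \<open>(J \<alpha>)(X) = \<alpha>(J X)\<close> one has \<open>J df = \<i> (\<partial>f - \<partial>\<^sup>cf)\<close>, where \<open>\<partial>\<^sup>cf\<close> is the (0,1) part of
  \<open>df\<close>; hence \<open>\<i> \<partial>\<partial>\<^sup>c f = - d (J df) / 2\<close>.\<close>

definition i_ddbar ::
  "'d::finite itself \<Rightarrow> (complex^'N) set \<Rightarrow> (complex^'N \<Rightarrow> real) \<Rightarrow> complex^'N \<Rightarrow> (nat \<Rightarrow> complex^'N) \<Rightarrow> real" where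
  "i_ddbar D M f p v = - (1/2) * ext_deriv D M 1 (\<lambda>q w. differential M f q (cJ (w 0))) p v"


section \<open>Radius functions\<close>

definition cone_metric ::
  "'d::finite itself \<Rightarrow> (complex^'N) set \<Rightarrow> (complex^'N \<Rightarrow> real) \<Rightarrow> complex^'N \<Rightarrow> complex^'N \<Rightarrow> complex^'N \<Rightarrow> real" where
  "cone_metric D M r p u w = 1/2 * i_ddbar D M (\<lambda>q. (r q)\<^sup>2) p (pair u (cJ w))"

definition unit_level :: "(complex^'N) set \<Rightarrow> (complex^'N \<Rightarrow> real) \<Rightarrow> (complex^'N) set" where
  "unit_level M r = {p\<in>M. r p = 1}"

text \<open>\<open>\<Phi>\<close> is a diffeomorphism from the product of the positive reals and the link \<open>S = {r = 1}\<close> onto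
  \<open>M\<close> that carries \<open>r\<close> to the first coordinate \<open>\<rho>\<close> and the metric to \<open>d\<rho>\<^sup>2 + \<rho>\<^sup>2 g\<^sub>S\<close>; since \<open>\<Phi>\<close> is
  the identity on \<open>\<rho> = 1\<close>, \<open>g\<^sub>S\<close> is necessarily the metric induced on \<open>S\<close>.\<close>

definition cone_map ::
  "'d::finite itself \<Rightarrow> (complex^'N) set \<Rightarrow> (complex^'N \<Rightarrow> real) \<Rightarrow> (real \<times> (complex^'N) \<Rightarrow> complex^'N) \<Rightarrow> bool" where
  "cone_map D M r \<Phi> \<longleftrightarrow>
     (let S = unit_level M r; C = {0<..} \<times> S in
      bij_betw \<Phi> C M \<and> smooth_map C \<Phi> \<and> smooth_map M (inv_into C \<Phi>) \<and>
      (\<forall>x\<in>S. \<Phi> (1, x) = x) \<and>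
      (\<forall>\<rho>>0. \<forall>x\<in>S. r (\<Phi> (\<rho>, x)) = \<rho> \<and>
         (\<forall>a b. \<forall>u\<in>tangent_space S x. \<forall>w\<in>tangent_space S x.
            cone_metric D M r (\<Phi> (\<rho>, x))
              (differential C \<Phi> (\<rho>, x) (a, u)) (differential C \<Phi> (\<rho>, x) (b, w))
            = a * b + \<rho>\<^sup>2 * cone_metric D M r x u w)))"

text \<open>The vector field \<open>r \<partial>\<^sub>r\<close>. The map \<open>\<Phi>\<close> is unique on its domain, because the curves
  \<open>\<rho> \<mapsto> \<Phi> (\<rho>, x)\<close> are the gradient curves of \<open>r\<close>.\<close>

definition euler_field ::
  "'d::finite itself \<Rightarrow> (complex^'N) set \<Rightarrow> (complex^'N \<Rightarrow> real) \<Rightarrow> complex^'N \<Rightarrow> complex^'N" where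
  "euler_field D M r p =
     (let \<Phi> = (SOME \<Phi>. cone_map D M r \<Phi>); C = {0<..} \<times> unit_level M r
      in r p *\<^sub>R differential C \<Phi> (inv_into C \<Phi> p) (1, 0))"

definition radius_function ::
  "'d::finite itself \<Rightarrow> (complex^'N) set \<Rightarrow> (complex^'k \<Rightarrow> complex^'N \<Rightarrow> complex^'N) \<Rightarrow> real^'k
     \<Rightarrow> (complex^'N \<Rightarrow> real) \<Rightarrow> bool" where
  "radius_function D M act \<xi> r \<longleftrightarrow>
     smooth_map M r \<and> (\<forall>p\<in>M. 0 < r p) \<and>
     (\<forall>t\<in>compact_torus. \<forall>p\<in>M. r (act t p) = r p) \<and>
     kahler_form D M (i_ddbar D M (\<lambda>p. (r p)\<^sup>2)) \<and>
     (\<exists>\<Phi>. cone_map D M r \<Phi>) \<and>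
     (\<forall>p\<in>M. cJ (euler_field D M r p) = torus_field act \<xi> p)"

definition deformation ::
  "'d::finite itself \<Rightarrow> (complex^'N) set \<Rightarrow> (complex^'k \<Rightarrow> complex^'N \<Rightarrow> complex^'N) \<Rightarrow> (complex^'N \<Rightarrow> real)
     \<Rightarrow> real^'k \<Rightarrow> (complex^'N \<Rightarrow> real) \<Rightarrow> bool" where
  "deformation D M act r0 \<xi> r \<longleftrightarrow>
     radius_function D M act \<xi> r \<and> unit_level M r = unit_level M r0"

definition contact_form :: "(complex^'N) set \<Rightarrow> (complex^'N \<Rightarrow> real) \<Rightarrow> complex^'N \<Rightarrow> complex^'N \<Rightarrow> real" where
  "contact_form M r p v = - differential M (\<lambda>q. ln (r q)) p (cJ v)"

definition contact_value ::
  "(complex^'k \<Rightarrow> complex^'N \<Rightarrow> complex^'N) \<Rightarrow> (complex^'N \<Rightarrow> complex^'N \<Rightarrow> real) \<Rightarrow> complex^'N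
     \<Rightarrow> real^'k \<Rightarrow> real" where
  "contact_value act \<eta> p = (\<lambda>\<zeta>. \<eta> p (torus_field act \<zeta> p))"

text \<open>The form \<open>(d\<eta>)\<^sup>n \<and> \<eta>\<close>.\<close>

definition contact_volume ::
  "'d::finite itself \<Rightarrow> (complex^'N) set \<Rightarrow> nat \<Rightarrow> (complex^'N \<Rightarrow> complex^'N \<Rightarrow> real) \<Rightarrow> complex^'N
     \<Rightarrow> (nat \<Rightarrow> complex^'N) \<Rightarrow> real" where
  "contact_volume D M n \<eta> p =
     wedge_list (replicate n (2, ext_deriv D M 1 (\<lambda>q w. \<eta> q (w 0)) p) @ [(1, \<lambda>w. \<eta> p (w 0))])"


section \<open>Pluricanonical sections and volume forms\<close>

text \<open>As \<open>K\<close> is a complex line at each point, every element of its \<open>m\<close>-th tensor power is \<open>\<omega>\<^sup>m\<close>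
  for some \<open>(d,0)\<close>-form \<open>\<omega>\<close>, unique up to an \<open>m\<close>-th root of unity; it is encoded as the function
  \<open>v \<mapsto> (\<omega> v) ^ m\<close> on \<open>d\<close>-tuples of tangent vectors. Sections of \<open>mK\<close> on a normal variety are sections over its
  regular locus; a nowhere vanishing one trivializes \<open>mK\<close>, so its existence makes the variety
  Q-Gorenstein.\<close>

definition is_root_form ::
  "(complex^'N) set \<Rightarrow> nat \<Rightarrow> nat \<Rightarrow> ((nat \<Rightarrow> complex^'N) \<Rightarrow> complex) \<Rightarrow> ((nat \<Rightarrow> complex^'N) \<Rightarrow> complex) \<Rightarrow> bool" where
  "is_root_form V d m \<sigma> \<omega> \<longleftrightarrow> alternating_on (*s) V d \<omega> \<and>
     (\<forall>v. (\<forall>i<d. v i \<in> V) \<longrightarrow> \<sigma> v = \<omega> v ^ m)"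

definition pluricanonical_section ::
  "'d::finite itself \<Rightarrow> (complex^'N) set \<Rightarrow> nat \<Rightarrow> (complex^'N \<Rightarrow> (nat \<Rightarrow> complex^'N) \<Rightarrow> complex) \<Rightarrow> bool" where
  "pluricanonical_section D M m s \<longleftrightarrow>
     (\<forall>p\<in>M. \<exists>\<omega>. is_root_form (tangent_space M p) CARD('d) m (s p) \<omega>) \<and>
     (\<forall>U (\<phi>::complex^'d \<Rightarrow> complex^'N). chart M U \<phi> \<longrightarrow>
        (\<forall>a. holomorphic_open U (\<lambda>x. s (\<phi> x) (\<lambda>i. frechet_derivative \<phi> (at x) (a i)))))"

definition nowhere_vanishing ::
  "'d::finite itself \<Rightarrow> (complex^'N) set \<Rightarrow> (complex^'N \<Rightarrow> (nat \<Rightarrow> complex^'N) \<Rightarrow> complex) \<Rightarrow> bool" where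
  "nowhere_vanishing D M s \<longleftrightarrow>
     (\<forall>p\<in>M. \<exists>v. (\<forall>i<CARD('d). v i \<in> tangent_space M p) \<and> s p v \<noteq> 0)"

text \<open>Equivariance means that \<open>s\<close> is semi-invariant: the pullback of \<open>s\<close> by \<open>t\<close> is \<open>s\<close> multiplied
  by the value at \<open>t\<close> of some character (invariance is impossible in the presence of a Reeb
  vector).\<close>

definition equivariant_section ::
  "'d::finite itself \<Rightarrow> (complex^'N) set \<Rightarrow> (complex^'k \<Rightarrow> complex^'N \<Rightarrow> complex^'N)
     \<Rightarrow> (complex^'N \<Rightarrow> (nat \<Rightarrow> complex^'N) \<Rightarrow> complex) \<Rightarrow> bool" where
  "equivariant_section D M act s \<longleftrightarrow>
     (\<exists>\<beta>. \<forall>t\<in>torus. \<forall>p\<in>M. \<forall>v. (\<forall>i<CARD('d). v i \<in> tangent_space M p) \<longrightarrow>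
        s (act t p) (\<lambda>i. differential M (act t) p (v i)) = torus_char \<beta> t * s p v)"

text \<open>If \<open>s = \<omega>\<^sup>m\<close> at a point, then the \<open>m\<close>-th root of \<open>\<i>^(m d\<^sup>2) s \<and> \<open>conj\<close> s\<close> is the positive real
  form \<open>\<i>^(d\<^sup>2) \<omega> \<and> \<open>conj\<close> \<omega>\<close>, for any choice of \<open>\<omega>\<close>.\<close>

definition volume_form ::
  "'d::finite itself \<Rightarrow> (complex^'N) set \<Rightarrow> nat \<Rightarrow> (complex^'N \<Rightarrow> (nat \<Rightarrow> complex^'N) \<Rightarrow> complex)
     \<Rightarrow> complex^'N \<Rightarrow> (nat \<Rightarrow> complex^'N) \<Rightarrow> real" where
  "volume_form D M m s p v =
     (let d = CARD('d); \<omega> = (SOME \<omega>. is_root_form (tangent_space M p) d m (s p) \<omega>)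
      in Re (\<i> ^ (d\<^sup>2) * wedge_list [(d, \<omega>), (d, \<lambda>w. cnj (\<omega> w))] v))"

text \<open>The form \<open>(\<iota>\<^bsub>E\<^esub> dV) / 2\<close>.\<close>

definition link_volume ::
  "(complex^'N \<Rightarrow> complex^'N) \<Rightarrow> (complex^'N \<Rightarrow> (nat \<Rightarrow> complex^'N) \<Rightarrow> real)
     \<Rightarrow> complex^'N \<Rightarrow> (nat \<Rightarrow> complex^'N) \<Rightarrow> real" where
  "link_volume E dV p v = 1/2 * dV p (case_nat (E p) v)"

definition forms_eq_on ::
  "(complex^'N) set \<Rightarrow> nat \<Rightarrow> (complex^'N \<Rightarrow> (nat \<Rightarrow> complex^'N) \<Rightarrow> real)
     \<Rightarrow> (complex^'N \<Rightarrow> (nat \<Rightarrow> complex^'N) \<Rightarrow> real) \<Rightarrow> bool" where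
  "forms_eq_on S k \<alpha> \<beta> \<longleftrightarrow>
     (\<forall>p\<in>S. \<forall>v. (\<forall>i<k. v i \<in> tangent_space S p) \<longrightarrow> \<alpha> p v = \<beta> p v)"

end

theory Submission
  imports Defs
begin

text \<open>At a point of the common link \<open>S\<close> both \<open>d log r\<close> and \<open>d log r\<^sub>0\<close> vanish on the hyperplane
  \<open>TS\<close>, so \<open>\<eta> = f \<eta>\<^sub>0\<close> there, and evaluating on \<open>\<xi>\<close> gives \<open>f = 1 / c\<close> with \<open>c = \<eta>\<^sub>0(\<xi>)\<close>. Restricted to
  \<open>S\<close>, \<open>d\<eta> = f d\<eta>\<^sub>0 + \<lambda> \<and> \<eta>\<^sub>0\<close>, hence \<open>(d\<eta>)\<^sup>n \<and> \<eta>\<close> is \<open>c\<close> to the power \<open>- n - 1\<close> times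
  \<open>(d\<eta>\<^sub>0)\<^sup>n \<and> \<eta>\<^sub>0\<close>. The Euler field of \<open>r\<close> is \<open>c\<close> times that of \<open>r\<^sub>0\<close> up to a vector tangent to \<open>S\<close>,
  so the two link volumes differ by the factor \<open>c\<close>. Together these give the weight \<open>- n - 2\<close>.\<close>

section \<open>Smooth maps, curves and charts\<close>

text \<open>The factor f exists only at points of the link, where the tangent spaces of the two
  level sets coincide, so \<eta> = f \<open>\<eta>\<^sub>0\<close> cannot be differentiated as an
  identity of forms on \<open>M\<close>. It can be differentiated in directions tangent to the link,
  which suffices because d\<eta> is only evaluated on such vectors; \<lambda> is then the derivative
  of f along the link. Two features shape the rest. J does not preserve the tangent space of the
  link, so the proportionality is needed on the whole tangent space of \<open>M\<close>, and the
  Euler field is split off for that purpose. Moreover a derivative within \<open>M\<close> is a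
  chosen value, determined only on tangent vectors, and tangent vectors are velocities of curves
  differentiable at a single time; so identities are tested along curves, while linearity and
  dimension of tangent spaces come from charts. The link gets its tangent space not from charts of
  its own but as the kernel of d log r, by means of the cone map.\<close>

lemma smooth_open_has_derivative:
  assumes "smooth_open U f" "x \<in> U"
  shows "(f has_derivative frechet_derivative f (at x)) (at x)"
proof -
  have "Ck_on (Suc 0) U f"
    using assms(1) unfolding smooth_open_def by blast
  then obtain f' where "(f has_derivative f') (at x)"
    using assms(2) by auto
  then show ?thesis
    by (meson differentiableI frechet_derivative_works)
qed

lemma smooth_open_derivative_differentiable:
  assumes "smooth_open U f" "open U" "x \<in> U"
  shows "(\<lambda>z. frechet_derivative f (at z) v) differentiable (at x)"
proof -
  have "Ck_on (Suc (Suc 0)) U f"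
    using assms(1) unfolding smooth_open_def by blast
  then obtain f' where f': "\<And>z. z \<in> U \<Longrightarrow> (f has_derivative f' z) (at z)"
    and "Ck_on (Suc 0) U (\<lambda>z. f' z v)"
    unfolding Ck_on.simps(2)[of "Suc 0"] by blast
  then obtain f'' where "((\<lambda>z. f' z v) has_derivative f'') (at x)"
    using assms(3) by auto
  moreover have "f' z v = frechet_derivative f (at z) v" if "z \<in> U" for z
    using frechet_derivative_at[OF f'[OF that]] by simp
  ultimately have "((\<lambda>z. frechet_derivative f (at z) v) has_derivative f'') (at x)"
    by (rule has_derivative_transform_within_open[OF _ assms(2,3)])
  then show ?thesis
    by (rule differentiableI)
qed

lemma smooth_open_subset:
  assumes "smooth_open U f" "V \<subseteq> U"
  shows "smooth_open V f"
proof -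
  have "Ck_on k V h" if "Ck_on k U h" for k and h :: "'a \<Rightarrow> 'b"
    using that
  proof (induction k arbitrary: h)
    case 0
    then show ?case using assms(2) by (auto intro: continuous_on_subset)
  next
    case (Suc k)
    then obtain f' where "\<forall>x\<in>U. (h has_derivative f' x) (at x)" "\<forall>v. Ck_on k U (\<lambda>x. f' x v)"
      by auto
    then have "\<forall>x\<in>V. (h has_derivative f' x) (at x)" "\<forall>v. Ck_on k V (\<lambda>x. f' x v)"
      using Suc.IH assms(2) by blast+
    then show ?case by auto
  qed
  then show ?thesis
    using assms(1) unfolding smooth_open_def by blast
qed

text \<open>A local smooth extension \<open>F\<close> supplies one derivative within
  \<open>M\<close>. The one selected by \<open>differential\<close> may differ from it off the
  tangent space, so it is only claimed to be some derivative.\<close>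

lemma smooth_map_has_differential:
  assumes "smooth_map M f" "p \<in> M"
  shows "(f has_derivative differential M f p) (at p within M)"
proof -
  obtain U F where U: "open U" "p \<in> U" "smooth_open U F" "\<And>x. x \<in> U \<inter> M \<Longrightarrow> F x = f x"
    using bspec[OF assms(1)[unfolded smooth_map_def] assms(2)] by (elim exE conjE) (rule that, assumption+, blast)
  have F: "(F has_derivative frechet_derivative F (at p)) (at p within M)"
    using smooth_open_has_derivative[OF U(3,2)] by (rule has_derivative_at_withinI)
  obtain e where e: "e > 0" "ball p e \<subseteq> U"
    using U(1,2) open_contains_ball by blast
  have "(f has_derivative frechet_derivative F (at p)) (at p within M)"
    by (rule has_derivative_transform_within[OF F e(1) assms(2)])
       (use U(4) e(2) in \<open>auto simp: subset_iff dist_commute\<close>)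
  then show ?thesis
    by (meson differentiableI frechet_derivative_works)
qed

text \<open>Any two derivatives within \<open>M\<close> agree on velocities of curves in
  \<open>M\<close>, since both produce the velocity of the image curve. This makes the choice hidden
  in \<open>differential\<close> harmless on tangent vectors.\<close>

lemma has_derivative_along_curve:
  assumes "(f has_derivative f') (at (\<gamma> 0) within M)" "range \<gamma> \<subseteq> M"
    and "(\<gamma> has_vector_derivative v) (at (0::real))"
  shows "((\<lambda>t. f (\<gamma> t)) has_vector_derivative f' v) (at 0)"
proof -
  have "(f has_derivative f') (at (\<gamma> 0) within range \<gamma>)"
    using assms(1,2) has_derivative_subset by blast
  then have "((f \<circ> \<gamma>) has_derivative (f' \<circ> (\<lambda>t. t *\<^sub>R v))) (at 0)"
    using diff_chain_within assms(3) unfolding has_vector_derivative_def by blast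
  moreover have "f' (t *\<^sub>R v) = t *\<^sub>R f' v" for t
    using has_derivative_bounded_linear[OF assms(1)] by (simp add: bounded_linear.linear linear_cmul)
  ultimately show ?thesis
    unfolding has_vector_derivative_def by (simp add: o_def)
qed

section \<open>Tangent spaces as sets of velocities\<close>

lemma tangent_space_mono: "A \<subseteq> B \<Longrightarrow> tangent_space A p \<subseteq> tangent_space B p"
  unfolding tangent_space_def by blast

text \<open>Near time 0 a curve in \<open>A\<close> through \<open>p\<close> stays in
  \<open>W\<close>, hence in \<open>B\<close>. Since \<open>tangent_space\<close> asks for the whole
  range to lie in the set, the curve is reset to \<open>p\<close> at all times when it is outside
  \<open>W\<close>.\<close>

lemma tangent_space_local:
  assumes "open W" "p \<in> W" "A \<inter> W \<subseteq> B"
  shows "tangent_space A p \<subseteq> tangent_space B p"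
proof
  fix v assume "v \<in> tangent_space A p"
  then obtain \<gamma> :: "real \<Rightarrow> 'a" where \<gamma>: "range \<gamma> \<subseteq> A" "\<gamma> 0 = p" "(\<gamma> has_vector_derivative v) (at 0)"
    unfolding tangent_space_def by blast
  have "continuous (at 0) \<gamma>"
    using \<gamma>(3) has_vector_derivative_continuous by blast
  then have "\<forall>\<^sub>F t in at 0. \<gamma> t \<in> W"
    using assms(1,2) \<gamma>(2) by (metis continuous_at tendsto_def)
  then have ev: "\<forall>\<^sub>F t in at 0. \<gamma> t = (if \<gamma> t \<in> W then \<gamma> t else p)"
    by eventually_elim simp
  have "((\<lambda>t. if \<gamma> t \<in> W then \<gamma> t else p) has_vector_derivative v) (at 0)"
    using \<gamma>(3) unfolding has_vector_derivative_def
    by (rule has_derivative_transform_eventually[OF _ ev]) (use assms(2) \<gamma>(2) in auto)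
  moreover have "range (\<lambda>t. if \<gamma> t \<in> W then \<gamma> t else p) \<subseteq> B"
    using assms \<gamma>(1,2) by (auto simp: subset_iff)
  ultimately show "v \<in> tangent_space B p"
    unfolding tangent_space_def using \<gamma>(2) assms(2) by (intro CollectI exI[of _ "\<lambda>t. if \<gamma> t \<in> W then \<gamma> t else p"]) auto
qed

section \<open>Holomorphic charts and lifting of curves\<close>

lemma chart_has_derivative:
  assumes "chart M U \<phi>" "z \<in> U"
  shows "(\<phi> has_derivative frechet_derivative \<phi> (at z)) (at z)"
  using assms smooth_open_has_derivative unfolding chart_def by blast

lemma chart_derivative_complex_linear:
  assumes "chart M U \<phi>" "z \<in> U"
  shows "frechet_derivative \<phi> (at z) (c *s v) = c *s frechet_derivative \<phi> (at z) v"
proof -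
  have *: "frechet_derivative \<phi> (at z) v $ j = frechet_derivative (\<lambda>x. \<phi> x $ j) (at z) v" for v j
  proof -
    have "((\<lambda>x. \<phi> x $ j) has_derivative (\<lambda>v. frechet_derivative \<phi> (at z) v $ j)) (at z)"
      by (rule bounded_linear.has_derivative[OF bounded_linear_vec_nth chart_has_derivative[OF assms]])
    from frechet_derivative_at[OF this, symmetric] show ?thesis by simp
  qed
  show ?thesis
    using assms unfolding chart_def holomorphic_open_def
    by (simp add: vec_eq_iff *)
qed

text \<open>The regular locus is covered by charts of \<open>Y\<close>, whereas radius functions
  live on \<open>Y\<close> without the fixed point. Deleting the closed preimage of that point from
  the parameter domain preserves every clause of \<open>chart\<close>.\<close>

lemma chart_remove_point:
  assumes "chart Y U \<phi>" "p \<in> \<phi> ` U" "p \<noteq> a"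
  obtains V where "chart (Y - {a}) V \<phi>" "p \<in> \<phi> ` V"
proof
  define V where "V = {x \<in> U. \<phi> x \<noteq> a}"
  have U: "open U" "smooth_open U \<phi>" "openin (top_of_set Y) (\<phi> ` U)"
    using assms(1) unfolding chart_def by auto
  obtain \<psi> where h: "homeomorphism U (\<phi> ` U) \<phi> \<psi>"
    using assms(1) unfolding chart_def by blast
  have im: "\<phi> ` V = \<phi> ` U - {a}"
    unfolding V_def by auto
  have "V = U \<inter> \<phi> -` (- {a})"
    unfolding V_def by auto
  then have "open V"
    using U(1)
    by (metis continuous_open_preimage homeomorphism_cont1[OF h] open_Compl closed_singleton)
  moreover have "smooth_open V \<phi>"
    using smooth_open_subset[OF U(2)] V_def by auto
  moreover have "holomorphic_open V (\<lambda>x. \<phi> x $ j)" for j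
    using assms(1) smooth_open_subset[of U _ V] unfolding chart_def holomorphic_open_def
    by (auto simp: V_def)
  moreover have "openin (top_of_set (Y - {a})) (\<phi> ` V)"
  proof -
    obtain T where "open T" "\<phi> ` U = Y \<inter> T"
      using U(3) openin_open by blast
    then have "\<phi> ` V = (Y - {a}) \<inter> T"
      using im by auto
    then show ?thesis
      using \<open>open T\<close> openin_open by blast
  qed
  moreover have "homeomorphism V (\<phi> ` V) \<phi> \<psi>"
    using h by (rule homeomorphism_of_subsets) (auto simp: V_def)
  moreover have "\<forall>x\<in>V. inj (frechet_derivative \<phi> (at x))"
    using assms(1) unfolding chart_def V_def by auto
  ultimately show "chart (Y - {a}) V \<phi>"
    unfolding chart_def by blast
  show "p \<in> \<phi> ` V"
    using assms(2,3) im by auto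
qed

text \<open>The derivative of a chart is bounded below, so a continuous lift of a curve that is
  differentiable at \<open>0\<close> moves by \<open>O(t)\<close> only, which makes the lift differentiable too.\<close>

lemma differentiable_lift:
  fixes f :: "'a::euclidean_space \<Rightarrow> 'b::euclidean_space" and c :: "real \<Rightarrow> 'a"
  assumes f: "(f has_derivative L) (at (c 0))" and "inj L"
    and c: "continuous (at 0) c"
    and \<gamma>: "((\<lambda>t. f (c t)) has_vector_derivative v) (at 0)"
  obtains a where "(c has_vector_derivative a) (at 0)" "L a = v"
proof -
  have L: "linear L"
    using f has_derivative_linear by blast
  obtain P where P: "linear P" "P \<circ> L = id"
    using linear_injective_left_inverse[OF L assms(2)] by blast
  have PL: "P (L h) = h" for h
    using P(2) by (metis comp_apply id_apply)
  have bP: "bounded_linear P"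
    using P(1) by (simp add: linear_conv_bounded_linear)
  define \<delta> where "\<delta> = (\<lambda>t. P (f (c t)))"
  have \<delta>: "(\<delta> has_derivative (\<lambda>t. t *\<^sub>R P v)) (at 0)"
    using bounded_linear.has_derivative[OF bP \<gamma>[unfolded has_vector_derivative_def]]
    by (simp add: \<delta>_def linear_cmul[OF P(1)])
  have F: "((\<lambda>x. P (f x)) has_derivative (\<lambda>h. h)) (at (c 0))"
    using bounded_linear.has_derivative[OF bP f] by (simp add: PL)
  have nearF: "\<forall>\<^sub>F t in at 0. norm (\<delta> t - \<delta> 0 - (c t - c 0)) \<le> e * norm (c t - c 0)" if "e > 0" for e
  proof -
    obtain d where d: "d > 0" "\<And>y. norm (y - c 0) < d \<Longrightarrow> norm (P (f y) - P (f (c 0)) - (y - c 0)) \<le> e * norm (y - c 0)"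
      using conjunct2[OF F[unfolded has_derivative_at_alt], rule_format, OF \<open>e > 0\<close>] by auto
    have "\<forall>\<^sub>F t in at 0. dist (c t) (c 0) < d"
      using c d(1) unfolding continuous_at by (rule tendstoD)
    then show ?thesis
      by eventually_elim (use d(2) in \<open>simp add: \<delta>_def dist_norm\<close>)
  qed
  have near\<delta>: "\<forall>\<^sub>F t in at 0. norm (\<delta> t - \<delta> 0 - t *\<^sub>R P v) \<le> e * \<bar>t\<bar>" if "e > 0" for e
  proof -
    obtain d where "d > 0" "\<And>y. norm (y - 0) < d \<Longrightarrow> norm (\<delta> y - \<delta> 0 - (y - 0) *\<^sub>R P v) \<le> e * norm (y - 0)"
      using conjunct2[OF \<delta>[unfolded has_derivative_at_alt], rule_format, OF \<open>e > 0\<close>] by auto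
    then show ?thesis
      unfolding eventually_at by (intro exI[of _ d]) auto
  qed
  \<comment> \<open>\<open>nearF\<close> with constant 1/2 lets half of the displacement of
    \<open>c\<close> be absorbed, giving at most twice the displacement of \<delta>;
    \<open>near\<delta>\<close> with constant 1 bounds the latter by
    \<open>(norm (P v) + 1) * \<bar>t\<bar>\<close>.\<close>
  define K where "K = 2 * (norm (P v) + 1)"
  have "K > 0"
    unfolding K_def by (simp add: add_nonneg_pos)
  have lip: "\<forall>\<^sub>F t in at 0. norm (c t - c 0) \<le> K * \<bar>t\<bar>"
    using nearF[of "1/2", OF half_gt_zero[OF zero_less_one]] near\<delta>[OF zero_less_one]
  proof eventually_elim
    case (elim t)
    have "norm (c t - c 0) \<le> norm (\<delta> t - \<delta> 0) + norm (\<delta> t - \<delta> 0 - (c t - c 0))"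
      using norm_triangle_sub[of "c t - c 0" "\<delta> t - \<delta> 0"] by (simp add: norm_minus_commute)
    moreover have "norm (\<delta> t - \<delta> 0) \<le> norm (t *\<^sub>R P v) + norm (\<delta> t - \<delta> 0 - t *\<^sub>R P v)"
      by (rule norm_triangle_sub)
    ultimately show ?case
      using elim unfolding K_def by (simp add: algebra_simps)
  qed
  have "(c has_derivative (\<lambda>t. t *\<^sub>R P v)) (at 0)"
    unfolding has_derivative_at_alt
  proof (intro conjI allI impI)
    show "bounded_linear (\<lambda>t. t *\<^sub>R P v)"
      by (rule bounded_linear_scaleR_left)
    fix e :: real assume "e > 0"
    have e': "e / (2 * K) > 0" "e / 2 > 0"
      using \<open>e > 0\<close> \<open>K > 0\<close> by simp_all
    have "\<forall>\<^sub>F t in at 0. norm (c t - c 0 - t *\<^sub>R P v) \<le> e * \<bar>t\<bar>"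
      using nearF[OF e'(1)] near\<delta>[OF e'(2)] lip
    proof eventually_elim
      case (elim t)
      have eq: "c t - c 0 - t *\<^sub>R P v = (\<delta> t - \<delta> 0 - t *\<^sub>R P v) - (\<delta> t - \<delta> 0 - (c t - c 0))"
        by simp
      have "norm (c t - c 0 - t *\<^sub>R P v) \<le> norm (\<delta> t - \<delta> 0 - t *\<^sub>R P v) + norm (\<delta> t - \<delta> 0 - (c t - c 0))"
        by (subst eq) (rule norm_triangle_ineq4)
      also have "\<dots> \<le> e / 2 * \<bar>t\<bar> + e / (2 * K) * (K * \<bar>t\<bar>)"
        using elim \<open>e > 0\<close> \<open>K > 0\<close>
        by (intro add_mono order.trans[OF elim(1)]) (auto intro!: mult_left_mono simp: field_simps)
      also have "\<dots> = e * \<bar>t\<bar>"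
        using \<open>K > 0\<close> by (simp add: field_simps)
      finally show ?case .
    qed
    then obtain d where "d > 0" "\<And>t. t \<noteq> 0 \<Longrightarrow> \<bar>t\<bar> < d \<Longrightarrow> norm (c t - c 0 - t *\<^sub>R P v) \<le> e * \<bar>t\<bar>"
      unfolding eventually_at by auto
    then show "\<exists>d>0. \<forall>y. norm (y - 0) < d \<longrightarrow> norm (c y - c 0 - (y - 0) *\<^sub>R P v) \<le> e * norm (y - 0)"
    proof (intro exI[of _ d] conjI allI impI)
      fix y :: real assume "norm (y - 0) < d"
      then show "norm (c y - c 0 - (y - 0) *\<^sub>R P v) \<le> e * norm (y - 0)"
        using \<open>\<And>t. t \<noteq> 0 \<Longrightarrow> \<bar>t\<bar> < d \<Longrightarrow> norm (c t - c 0 - t *\<^sub>R P v) \<le> e * \<bar>t\<bar>\<close>[of y]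
        by (cases "y = 0") auto
    qed
  qed
  then have ca: "(c has_vector_derivative P v) (at 0)"
    unfolding has_vector_derivative_def .
  \<comment> \<open>\<open>P\<close> is only a left inverse of \<open>L\<close>, and
    \<open>v\<close> is not known in advance to lie in the range of \<open>L\<close>;
    \<open>L (P v) = v\<close> follows by computing the velocity of the image curve a second
    time.\<close>
  have "((\<lambda>t. f (c t)) has_vector_derivative L (P v)) (at 0)"
    using has_derivative_along_curve[of f L c UNIV "P v"] f ca by simp
  then have "L (P v) = v"
    using \<gamma> vector_derivative_unique_at by blast
  with ca show ?thesis
    using that by blast
qed

text \<open>The inverse of a chart is merely continuous by definition, so the lift is first obtained
  as a continuous curve and \<open>differentiable_lift\<close> then provides its velocity. The image
  of a chart is relatively open in \<open>M\<close>, so \<gamma> stays in it near time 0 only; at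
  other times the lift is set to \<open>x\<close> to remain in \<open>U\<close>.\<close>

lemma chart_lift_curve:
  fixes \<phi> :: "complex^'d::finite \<Rightarrow> complex^'N::finite" and \<gamma> :: "real \<Rightarrow> complex^'N"
  assumes ch: "chart M U \<phi>" and x: "x \<in> U" "\<gamma> 0 = \<phi> x" and \<gamma>: "range \<gamma> \<subseteq> M"
    and d: "(\<gamma> has_vector_derivative v) (at 0)"
  obtains c a where "c 0 = x" "range c \<subseteq> U" "(c has_vector_derivative a) (at 0)"
    "frechet_derivative \<phi> (at x) a = v" "\<forall>\<^sub>F t in at 0. \<phi> (c t) = \<gamma> t"
proof -
  obtain \<psi> where h: "homeomorphism U (\<phi> ` U) \<phi> \<psi>"
    using ch unfolding chart_def by blast
  obtain T where T: "open T" "\<phi> ` U = M \<inter> T"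
    using ch openin_open unfolding chart_def by metis
  define c where "c = (\<lambda>t. if \<gamma> t \<in> T then \<psi> (\<gamma> t) else x)"
  have cont: "continuous (at 0) \<gamma>"
    using d has_vector_derivative_continuous by blast
  have ev: "\<forall>\<^sub>F t in at 0. \<gamma> t \<in> T"
    using cont T x by (metis IntD2 continuous_at imageI tendsto_def)
  have inU: "\<gamma> t \<in> \<phi> ` U" if "\<gamma> t \<in> T" for t
    using that T(2) \<gamma> by auto
  have c0: "c 0 = x"
    using x inU h by (simp add: c_def homeomorphism_apply1)
  have cU: "range c \<subseteq> U"
    using inU x homeomorphism_image2[OF h] by (auto simp: c_def)
  have \<phi>c: "\<phi> (c t) = \<gamma> t" if "\<gamma> t \<in> T" for t
    using that inU h by (simp add: c_def homeomorphism_apply2)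
  have ev\<phi>: "\<forall>\<^sub>F t in at 0. \<phi> (c t) = \<gamma> t"
    using ev by eventually_elim (rule \<phi>c)
  have "((\<lambda>t. \<psi> (\<gamma> t)) \<longlongrightarrow> \<psi> (\<phi> x)) (at 0)"
  proof (rule continuous_on_tendsto_compose[OF homeomorphism_cont2[OF h]])
    show "(\<gamma> \<longlongrightarrow> \<phi> x) (at 0)"
      using cont x(2) by (simp add: continuous_at)
    show "\<forall>\<^sub>F t in at 0. \<gamma> t \<in> \<phi> ` U"
      using ev by eventually_elim (rule inU)
  qed (use x in simp)
  moreover have "\<forall>\<^sub>F t in at 0. \<psi> (\<gamma> t) = c t"
    using ev by eventually_elim (simp add: c_def)
  ultimately have "(c \<longlongrightarrow> \<psi> (\<phi> x)) (at 0)"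
    by (rule Lim_transform_eventually)
  then have "(c \<longlongrightarrow> c 0) (at 0)"
    using c0 homeomorphism_apply1[OF h x(1)] by simp
  then have "continuous (at 0) c"
    by (simp add: continuous_at)
  moreover have "((\<lambda>t. \<phi> (c t)) has_vector_derivative v) (at 0)"
    using d unfolding has_vector_derivative_def
    by (rule has_derivative_transform_eventually) (use ev\<phi> c0 x in \<open>auto elim: eventually_mono\<close>)
  moreover have "inj (frechet_derivative \<phi> (at x))"
    using ch x unfolding chart_def by blast
  ultimately obtain a where "(c has_vector_derivative a) (at 0)" "frechet_derivative \<phi> (at x) a = v"
    using differentiable_lift[of \<phi> "frechet_derivative \<phi> (at x)" c v] chart_has_derivative[OF ch x(1)] c0
    by metis
  then show ?thesis
    using that c0 cU ev\<phi> by blast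
qed

text \<open>One inclusion lifts curves to the chart; for the other, straight lines in
  \<open>U\<close> are pushed forward and frozen at \<open>\<phi> x\<close> once they leave
  \<open>U\<close>. The velocities thereby acquire a linear structure.\<close>

lemma tangent_space_chart:
  fixes \<phi> :: "complex^'d::finite \<Rightarrow> complex^'N::finite"
  assumes ch: "chart M U \<phi>" and x: "x \<in> U"
  shows "tangent_space M (\<phi> x) = range (frechet_derivative \<phi> (at x))"
proof
  show "tangent_space M (\<phi> x) \<subseteq> range (frechet_derivative \<phi> (at x))"
  proof
    fix v assume "v \<in> tangent_space M (\<phi> x)"
    then obtain \<gamma> :: "real \<Rightarrow> complex^'N" where "range \<gamma> \<subseteq> M" "\<gamma> 0 = \<phi> x"
      "(\<gamma> has_vector_derivative v) (at 0)"
      unfolding tangent_space_def by blast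
    then obtain a where "frechet_derivative \<phi> (at x) a = v"
      using chart_lift_curve[OF ch x] by metis
    then show "v \<in> range (frechet_derivative \<phi> (at x))"
      by blast
  qed
  show "range (frechet_derivative \<phi> (at x)) \<subseteq> tangent_space M (\<phi> x)"
  proof clarify
    fix a
    have U: "open U" "\<phi> ` U \<subseteq> M"
      using ch openin_imp_subset unfolding chart_def by blast+
    define \<gamma> where "\<gamma> t = (if x + t *\<^sub>R a \<in> U then \<phi> (x + t *\<^sub>R a) else \<phi> x)" for t :: real
    have l: "((\<lambda>t. x + t *\<^sub>R a) has_vector_derivative a) (at 0)"
      by (auto intro!: derivative_eq_intros)
    then have "((\<lambda>t. \<phi> (x + t *\<^sub>R a)) has_vector_derivative frechet_derivative \<phi> (at x) a) (at 0)"
      using has_derivative_along_curve[of \<phi> _ "\<lambda>t. x + t *\<^sub>R a" UNIV a] chart_has_derivative[OF ch x] by simp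
    moreover have "\<forall>\<^sub>F t in at 0. x + t *\<^sub>R a \<in> U"
    proof -
      have "((\<lambda>t. x + t *\<^sub>R a) \<longlongrightarrow> x) (at 0)"
        using has_vector_derivative_continuous[OF l] by (simp add: continuous_at)
      then show ?thesis
        using U(1) x by (metis tendsto_def)
    qed
    then have "\<forall>\<^sub>F t in at 0. \<phi> (x + t *\<^sub>R a) = \<gamma> t"
      by eventually_elim (simp add: \<gamma>_def)
    ultimately have "(\<gamma> has_vector_derivative frechet_derivative \<phi> (at x) a) (at 0)"
      unfolding has_vector_derivative_def
      by (rule has_derivative_transform_eventually) (use x in \<open>auto simp: \<gamma>_def\<close>)
    moreover have "range \<gamma> \<subseteq> M" "\<gamma> 0 = \<phi> x"
      using U x by (auto simp: \<gamma>_def)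
    ultimately show "frechet_derivative \<phi> (at x) a \<in> tangent_space M (\<phi> x)"
      unfolding tangent_space_def by blast
  qed
qed

section \<open>Radius functions\<close>

lemma radius_log_has_derivative:
  assumes "radius_function D M act \<xi> r" "p \<in> M"
  shows "((\<lambda>q. ln (r q)) has_derivative differential M (\<lambda>q. ln (r q)) p) (at p within M)"
proof -
  have r: "smooth_map M r" "0 < r p"
    using assms unfolding radius_function_def by auto
  have "((\<lambda>q. ln (r q)) has_derivative (\<lambda>v. differential M r p v * inverse (r p))) (at p within M)"
    using r(2) smooth_map_has_differential[OF r(1) assms(2)]
    by (auto intro!: derivative_eq_intros simp: field_simps)
  then show ?thesis
    by (meson differentiableI frechet_derivative_works)
qed

text \<open>The curve is the ray of the cone through \<open>p\<close>, run with parameter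
  \<open>r p * exp t\<close>: its velocity at time 0 is then \<open>r p\<close> times the radial
  derivative of the cone map selected in \<open>euler_field\<close>, and log r grows at unit
  speed.\<close>

lemma euler_field_curve:
  assumes r: "radius_function D M act \<xi> r" and p: "p \<in> M"
  obtains \<gamma> :: "real \<Rightarrow> complex^'N::finite" where "range \<gamma> \<subseteq> M" "\<gamma> 0 = p"
    "(\<gamma> has_vector_derivative euler_field D M r p) (at 0)" "\<And>t. r (\<gamma> t) = r p * exp t"
proof -
  define \<Phi> where "\<Phi> = (SOME \<Phi>. cone_map D M r \<Phi>)"
  define C where "C = {0::real<..} \<times> unit_level M r"
  have "\<exists>\<Phi>. cone_map D M r \<Phi>"
    using r unfolding radius_function_def by blast
  then have "cone_map D M r \<Phi>"
    unfolding \<Phi>_def by (rule someI_ex)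
  then have \<Phi>: "bij_betw \<Phi> C M" "smooth_map C \<Phi>"
    "\<And>\<rho> x. 0 < \<rho> \<Longrightarrow> x \<in> unit_level M r \<Longrightarrow> r (\<Phi> (\<rho>, x)) = \<rho>"
    unfolding cone_map_def Let_def C_def by blast+
  obtain \<rho> x where x: "inv_into C \<Phi> p = (\<rho>, x)"
    by (cases "inv_into C \<Phi> p")
  have xC: "(\<rho>, x) \<in> C" and \<Phi>x: "\<Phi> (\<rho>, x) = p"
    using \<Phi>(1) p x by (metis bij_betw_def inv_into_into, metis bij_betw_inv_into_right)
  then have \<rho>: "\<rho> = r p" "0 < r p"
    using \<Phi>(3)[of \<rho> x] by (auto simp: C_def)
  define \<sigma> where "\<sigma> t = (r p * exp t, x)" for t
  have \<sigma>: "range \<sigma> \<subseteq> C" "\<sigma> 0 = (r p, x)"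
    using xC \<rho> by (auto simp: \<sigma>_def C_def)
  have "(\<sigma> has_vector_derivative (r p, 0)) (at 0)"
    unfolding \<sigma>_def
    by (auto intro!: derivative_eq_intros has_vector_derivative_Pair
      simp flip: has_real_derivative_iff_has_vector_derivative)
  moreover have D: "(\<Phi> has_derivative differential C \<Phi> (r p, x)) (at (r p, x) within C)"
    using smooth_map_has_differential[OF \<Phi>(2)] xC \<rho>(1) by blast
  ultimately have "((\<lambda>t. \<Phi> (\<sigma> t)) has_vector_derivative differential C \<Phi> (r p, x) (r p, 0)) (at 0)"
    using has_derivative_along_curve[of \<Phi> _ \<sigma> C] \<sigma> by simp
  moreover have "differential C \<Phi> (r p, x) (r p *\<^sub>R (1, 0)) = r p *\<^sub>R differential C \<Phi> (r p, x) (1, 0)"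
    using has_derivative_linear[OF D] by (rule linear_cmul)
  then have "differential C \<Phi> (r p, x) (r p, 0) = euler_field D M r p"
    unfolding euler_field_def Let_def \<Phi>_def[symmetric] C_def[symmetric] x \<rho>(1) by simp
  moreover have "range (\<lambda>t. \<Phi> (\<sigma> t)) \<subseteq> M"
    using \<sigma>(1) \<Phi>(1) unfolding bij_betw_def by blast
  moreover have "r (\<Phi> (\<sigma> t)) = r p * exp t" for t
    using \<Phi>(3)[of "r p * exp t" x] xC \<rho>(2) by (simp add: \<sigma>_def C_def)
  moreover have "\<Phi> (\<sigma> 0) = p"
    using \<sigma>(2) \<Phi>x \<rho>(1) by simp
  ultimately show ?thesis
    using that[of "\<lambda>t. \<Phi> (\<sigma> t)"] by simp
qed

lemma euler_field_tangent:
  assumes "radius_function D M act \<xi> r" "p \<in> M"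
  shows "euler_field D M r p \<in> tangent_space M p"
  using euler_field_curve[OF assms] unfolding tangent_space_def by blast

lemma log_radius_euler_field:
  assumes r: "radius_function D M act \<xi> r" and p: "p \<in> M"
  shows "differential M (\<lambda>q. ln (r q)) p (euler_field D M r p) = 1"
proof -
  have "0 < r p"
    using r p unfolding radius_function_def by blast
  obtain \<gamma> where \<gamma>: "range \<gamma> \<subseteq> M" "\<gamma> 0 = p"
    "(\<gamma> has_vector_derivative euler_field D M r p) (at 0)" "\<And>t. r (\<gamma> t) = r p * exp t"
    using euler_field_curve[OF r p] by blast
  have "((\<lambda>t. ln (r (\<gamma> t))) has_vector_derivative
          differential M (\<lambda>q. ln (r q)) p (euler_field D M r p)) (at 0)"
    using has_derivative_along_curve[of "\<lambda>q. ln (r q)" _ \<gamma> M] radius_log_has_derivative[OF r p] \<gamma>(1-3)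
    by simp
  moreover have "(\<lambda>t. ln (r (\<gamma> t))) = (\<lambda>t. ln (r p) + t)"
    using \<open>0 < r p\<close> by (simp add: \<gamma>(4) ln_mult)
  moreover have "((\<lambda>t. ln (r p) + t) has_vector_derivative 1) (at 0)"
    by (auto intro!: derivative_eq_intros)
  ultimately show ?thesis
    by (metis vector_derivative_unique_at)
qed

text \<open>Projecting a curve in \<open>M\<close> along the rays of the cone gives a curve in the link; if \<open>r\<close> is
  stationary along the curve, this does not change the velocity.\<close>

lemma tangent_space_unit_level:
  assumes r: "radius_function D M act \<xi> r" and p: "p \<in> unit_level M r"
  shows "tangent_space (unit_level M r) p
       = {v \<in> tangent_space M p. differential M (\<lambda>q. ln (r q)) p v = 0}"
proof (intro subset_antisym subsetI)
  define S where "S = unit_level M r"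
  have pM: "p \<in> M" and SM: "S \<subseteq> M"
    using p unfolding unit_level_def S_def by auto
  note dlog = radius_log_has_derivative[OF r pM]
  fix v assume "v \<in> tangent_space (unit_level M r) p"
  then obtain \<gamma> :: "real \<Rightarrow> complex^'b" where \<gamma>: "range \<gamma> \<subseteq> S" "\<gamma> 0 = p" "(\<gamma> has_vector_derivative v) (at 0)"
    unfolding tangent_space_def S_def by blast
  have "range \<gamma> \<subseteq> M"
    using \<gamma>(1) SM by blast
  then have "((\<lambda>t. ln (r (\<gamma> t))) has_vector_derivative differential M (\<lambda>q. ln (r q)) p v) (at 0)"
    using has_derivative_along_curve[of "\<lambda>q. ln (r q)" _ \<gamma> M] dlog \<gamma>(2,3) by simp
  moreover have "ln (r (\<gamma> t)) = 0" for t
    using \<gamma>(1) unfolding S_def unit_level_def by (simp add: image_subset_iff)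
  ultimately have "((\<lambda>t. 0) has_vector_derivative differential M (\<lambda>q. ln (r q)) p v) (at 0)"
    by simp
  then have "differential M (\<lambda>q. ln (r q)) p v = 0"
    using has_vector_derivative_const vector_derivative_unique_at by blast
  moreover have "v \<in> tangent_space M p"
    using \<gamma> SM unfolding tangent_space_def by blast
  ultimately show "v \<in> {v \<in> tangent_space M p. differential M (\<lambda>q. ln (r q)) p v = 0}"
    by blast
next
  define S where "S = unit_level M r"
  have pM: "p \<in> M" and SM: "S \<subseteq> M"
    using p unfolding unit_level_def S_def by auto
  note dlog = radius_log_has_derivative[OF r pM]
  fix v assume "v \<in> {v \<in> tangent_space M p. differential M (\<lambda>q. ln (r q)) p v = 0}"
  then obtain \<gamma> :: "real \<Rightarrow> complex^'b" where v: "differential M (\<lambda>q. ln (r q)) p v = 0"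
    and \<gamma>: "range \<gamma> \<subseteq> M" "\<gamma> 0 = p" "(\<gamma> has_vector_derivative v) (at 0)"
    unfolding tangent_space_def by blast
  obtain \<Phi> where "cone_map D M r \<Phi>"
    using r unfolding radius_function_def by blast
  define C where "C = {0::real<..} \<times> S"
  define \<Psi> where "\<Psi> = inv_into C \<Phi>"
  have \<Phi>: "bij_betw \<Phi> C M" "smooth_map C \<Phi>" "smooth_map M \<Psi>" "\<And>x. x \<in> S \<Longrightarrow> \<Phi> (1, x) = x"
    "\<And>\<rho> x. 0 < \<rho> \<Longrightarrow> x \<in> S \<Longrightarrow> r (\<Phi> (\<rho>, x)) = \<rho>"
    using \<open>cone_map D M r \<Phi>\<close> unfolding cone_map_def Let_def C_def S_def \<Psi>_def by blast+
  have pC: "(1, p) \<in> C"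
    using p by (simp add: C_def S_def)
  have \<Psi>p: "\<Psi> p = (1, p)"
    using bij_betw_inv_into_left[OF \<Phi>(1) pC] \<Phi>(4) p by (simp add: \<Psi>_def S_def)
  have \<Psi>C: "\<Psi> q \<in> C" and \<Phi>\<Psi>: "\<Phi> (\<Psi> q) = q" if "q \<in> M" for q
    using \<Phi>(1) that by (metis \<Psi>_def bij_betw_def inv_into_into, metis \<Psi>_def bij_betw_inv_into_right)
  define \<sigma> where "\<sigma> t = \<Psi> (\<gamma> t)" for t
  have \<sigma>C: "\<sigma> t \<in> C" and \<Phi>\<sigma>: "\<Phi> (\<sigma> t) = \<gamma> t" for t
    using \<gamma>(1) \<Psi>C \<Phi>\<Psi> unfolding \<sigma>_def by (auto simp: image_subset_iff)
  define w where "w = differential M \<Psi> p v"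
  have \<sigma>': "(\<sigma> has_vector_derivative w) (at 0)"
    using has_derivative_along_curve[of \<Psi> _ \<gamma> M] smooth_map_has_differential[OF \<Phi>(3) pM] \<gamma>
    unfolding \<sigma>_def w_def by simp
  have fst\<sigma>: "((\<lambda>t. fst (\<sigma> t)) has_vector_derivative fst w) (at 0)"
    and snd\<sigma>: "((\<lambda>t. snd (\<sigma> t)) has_vector_derivative snd w) (at 0)"
    using has_derivative_fst[OF \<sigma>'[unfolded has_vector_derivative_def]]
      has_derivative_snd[OF \<sigma>'[unfolded has_vector_derivative_def]]
    unfolding has_vector_derivative_def by simp_all
  \<comment> \<open>The radial coordinate is \<open>r\<close>; writing it as
    \<open>exp (ln ...)\<close> allows the hypothesis on d log r to show that it is
    stationary.\<close>
  have "fst (\<sigma> t) = exp (ln (r (\<gamma> t)))" for t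
  proof -
    have "0 < fst (\<sigma> t)" "snd (\<sigma> t) \<in> S"
      using \<sigma>C[of t] by (auto simp: C_def)
    then show ?thesis
      using \<Phi>(5)[of "fst (\<sigma> t)" "snd (\<sigma> t)"] \<Phi>\<sigma>[of t] by simp
  qed
  moreover have "((\<lambda>t. exp (ln (r (\<gamma> t)))) has_vector_derivative 0) (at 0)"
  proof -
    have "((\<lambda>t. ln (r (\<gamma> t))) has_vector_derivative 0) (at 0)"
      using has_derivative_along_curve[of "\<lambda>q. ln (r q)" "differential M (\<lambda>q. ln (r q)) p" \<gamma> M v]
        dlog \<gamma> v by simp
    then have "((\<lambda>t. ln (r (\<gamma> t))) has_real_derivative 0) (at 0)"
      by (simp add: has_real_derivative_iff_has_vector_derivative)
    from DERIV_fun_exp[OF this] show ?thesis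
      by (simp add: has_real_derivative_iff_has_vector_derivative)
  qed
  ultimately have "fst w = 0"
    using fst\<sigma> vector_derivative_unique_at by fastforce
  note D = smooth_map_has_differential[OF \<Phi>(2) pC]
  have "((\<lambda>t. \<Phi> (\<sigma> t)) has_vector_derivative differential C \<Phi> (1, p) w) (at 0)"
    using has_derivative_along_curve[of \<Phi> _ \<sigma> C w] D \<sigma>C \<sigma>' \<Psi>p \<gamma>(2) by (simp add: image_subset_iff \<sigma>_def)
  then have v_eq: "differential C \<Phi> (1, p) w = v"
    using \<gamma>(3) \<Phi>\<sigma> vector_derivative_unique_at by (metis (no_types, lifting) ext)
  define x where "x t = snd (\<sigma> t)" for t
  have xS: "x t \<in> S" for t
    using \<sigma>C[of t] by (auto simp: x_def C_def)
  have x0: "x 0 = p"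
    using \<Psi>p \<gamma>(2) by (simp add: x_def \<sigma>_def)
  have x': "(x has_vector_derivative snd w) (at 0)"
    using snd\<sigma> unfolding x_def .
  have "((\<lambda>t. (1::real, x t)) has_vector_derivative w) (at 0)"
    using has_vector_derivative_Pair[OF has_vector_derivative_const x', of 1] \<open>fst w = 0\<close>
    by (metis prod.collapse)
  then have "((\<lambda>t. \<Phi> (1, x t)) has_vector_derivative differential C \<Phi> (1, p) w) (at 0)"
    using has_derivative_along_curve[of \<Phi> _ "\<lambda>t. (1, x t)" C w] D xS x0
    by (simp add: image_subset_iff C_def)
  then have "(x has_vector_derivative v) (at 0)"
    using \<Phi>(4) xS v_eq by simp
  then show "v \<in> tangent_space (unit_level M r) p"
    unfolding tangent_space_def using xS x0 by (auto simp: S_def intro!: exI[of _ x])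
qed

lemma torus_field_eq:
  assumes "radius_function D M act \<xi> r" "p \<in> M"
  shows "torus_field act \<xi> p = cJ (euler_field D M r p)"
  using assms unfolding radius_function_def by metis

lemma cJ_cJ: "cJ (cJ v) = - v"
  by (simp add: vec_eq_iff)

lemma subspace_tangent_space_chart:
  fixes \<phi> :: "complex^'d::finite \<Rightarrow> complex^'N::finite"
  assumes "chart M U \<phi>" "p \<in> \<phi> ` U"
  shows "subspace (tangent_space M p)"
    and "v \<in> tangent_space M p \<Longrightarrow> c *s v \<in> tangent_space M p"
    and "dim (tangent_space M p) = 2 * CARD('d)"
proof -
  obtain x where x: "x \<in> U" "p = \<phi> x"
    using assms(2) by blast
  note T = tangent_space_chart[OF assms(1) x(1), folded x(2)]
  have L: "linear (frechet_derivative \<phi> (at x))"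
    using chart_has_derivative[OF assms(1) x(1)] has_derivative_linear by blast
  show "subspace (tangent_space M p)"
    unfolding T by (rule linear_subspace_image[OF L subspace_UNIV])
  show "c *s v \<in> tangent_space M p" if "v \<in> tangent_space M p"
  proof -
    obtain b where "v = frechet_derivative \<phi> (at x) b"
      using \<open>v \<in> tangent_space M p\<close> unfolding T by blast
    then have "c *s v = frechet_derivative \<phi> (at x) (c *s b)"
      by (simp add: chart_derivative_complex_linear[OF assms(1) x(1)])
    then show ?thesis
      unfolding T by simp
  qed
  have "\<forall>x\<in>U. inj (frechet_derivative \<phi> (at x))"
    using assms(1) by (simp add: chart_def)
  then have "inj_on (frechet_derivative \<phi> (at x)) (span UNIV)"
    using x(1) by simp
  from dim_image_eq[OF L this]
  have "dim (tangent_space M p) = dim (UNIV :: (complex^'d) set)"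
    unfolding T .
  also have "\<dots> = 2 * CARD('d)"
    by (simp add: dim_UNIV)
  finally show "dim (tangent_space M p) = 2 * CARD('d)" .
qed

text \<open>Both differentials vanish on the tangent space of the common link, which is a hyperplane.\<close>

lemma log_radius_proportional:
  assumes r0: "radius_function D M act \<xi>0 r0" and r: "radius_function D M act \<xi> r"
    and S: "unit_level M r = unit_level M r0" and p: "p \<in> unit_level M r0"
    and T: "subspace (tangent_space M p)" and v: "v \<in> tangent_space M p"
  shows "differential M (\<lambda>q. ln (r q)) p v
       = differential M (\<lambda>q. ln (r q)) p (euler_field D M r0 p) * differential M (\<lambda>q. ln (r0 q)) p v"
proof -
  have pM: "p \<in> M"
    using p unfolding unit_level_def by blast
  define E where "E = euler_field D M r0 p"
  define l l0 where "l = differential M (\<lambda>q. ln (r q)) p" and "l0 = differential M (\<lambda>q. ln (r0 q)) p"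
  have lin: "linear l" "linear l0"
    unfolding l_def l0_def
    using radius_log_has_derivative[OF r pM] radius_log_has_derivative[OF r0 pM] has_derivative_linear by blast+
  have E: "E \<in> tangent_space M p" "l0 E = 1"
    unfolding E_def l0_def by (rule euler_field_tangent[OF r0 pM], rule log_radius_euler_field[OF r0 pM])
  \<comment> \<open>This is the component of \<open>v\<close> tangent to the link in the splitting
    of the tangent space of \<open>M\<close> into that of the link and the line of \<open>E\<close>;
    it is killed by \<open>l0\<close>, hence by \<open>l\<close>.\<close>
  have "v - l0 v *\<^sub>R E \<in> tangent_space M p"
    using T v E(1) by (simp add: subspace_diff subspace_scale)
  moreover have "l0 (v - l0 v *\<^sub>R E) = 0"
    using E(2) by (simp add: linear_diff[OF lin(2)] linear_cmul[OF lin(2)])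
  ultimately have "v - l0 v *\<^sub>R E \<in> tangent_space (unit_level M r) p"
    using tangent_space_unit_level[OF r0 p] S unfolding l0_def by simp
  then have "l (v - l0 v *\<^sub>R E) = 0"
    using tangent_space_unit_level[OF r] p S unfolding l_def by auto
  then show ?thesis
    unfolding l_def[symmetric] l0_def[symmetric] E_def[symmetric]
    by (simp add: linear_diff[OF lin(1)] linear_cmul[OF lin(1)])
qed

section \<open>First and second derivatives of log r in a chart\<close>

lemma chart_log_radius_has_derivative:
  assumes r: "radius_function D M act \<xi> r" and ch: "chart M U \<phi>" and z: "z \<in> U"
  shows "((\<lambda>y. ln (r (\<phi> y))) has_derivative
           (\<lambda>b. differential M (\<lambda>q. ln (r q)) (\<phi> z) (frechet_derivative \<phi> (at z) b))) (at z)"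
proof -
  have U: "open U" "\<phi> ` U \<subseteq> M"
    using ch openin_imp_subset unfolding chart_def by blast+
  have "((\<lambda>q. ln (r q)) has_derivative differential M (\<lambda>q. ln (r q)) (\<phi> z)) (at (\<phi> z) within \<phi> ` U)"
    using radius_log_has_derivative[OF r, of "\<phi> z"] U(2) z has_derivative_subset by blast
  moreover have "(\<phi> has_derivative frechet_derivative \<phi> (at z)) (at z within U)"
    using chart_has_derivative[OF ch z] has_derivative_at_withinI by blast
  ultimately have "((\<lambda>q. ln (r q)) \<circ> \<phi> has_derivative
      differential M (\<lambda>q. ln (r q)) (\<phi> z) \<circ> frechet_derivative \<phi> (at z)) (at z within U)"
    by (intro diff_chain_within)
  then show ?thesis
    using at_within_open[OF z U(1)] by (simp add: o_def)
qed

text \<open>Differentiating a contact form amounts to differentiating log r twice. Here the first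
  derivative is evaluated at the moving point \<open>\<phi> z\<close> in a moving direction, and it
  is defined through an extension \<open>F\<close> of \<open>r\<close> that exists only near one
  point.\<close>

lemma chart_log_radius_derivative_differentiable:
  fixes \<phi> :: "complex^'d::finite \<Rightarrow> complex^'N::finite"
  assumes r: "radius_function D M act \<xi> r" and ch: "chart M U \<phi>" and x: "x \<in> U"
  shows "(\<lambda>z. differential M (\<lambda>q. ln (r q)) (\<phi> z) (frechet_derivative \<phi> (at z) b)) differentiable (at x)"
proof -
  have U: "open U" "\<phi> ` U \<subseteq> M" "smooth_open U \<phi>"
    using ch openin_imp_subset unfolding chart_def by blast+
  have rs: "smooth_map M r" "\<And>q. q \<in> M \<Longrightarrow> 0 < r q"
    using r unfolding radius_function_def by auto
  have "\<phi> x \<in> M"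
    using U(2) x by blast
  then have "\<exists>W F. open W \<and> \<phi> x \<in> W \<and> smooth_open W F \<and> (\<forall>y\<in>W \<inter> M. F y = r y)"
    using rs(1) unfolding smooth_map_def by (rule bspec[rotated])
  then obtain W F where W: "open W" "\<phi> x \<in> W" "smooth_open W F" "\<And>y. y \<in> W \<inter> M \<Longrightarrow> F y = r y"
    by (elim exE conjE) (rule that, assumption+, blast)
  define V where "V = U \<inter> \<phi> -` W"
  have "continuous_on U \<phi>"
    using chart_has_derivative[OF ch] has_derivative_continuous
    by (metis continuous_at_imp_continuous_on)
  then have V: "open V" "x \<in> V" "V \<subseteq> U"
    using U(1) W(1,2) x unfolding V_def by (auto intro: continuous_open_preimage)
  \<comment> \<open>Differentiability of the derivative of \<open>F\<close> is available for fixed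
    directions only, so the moving direction is expanded in the standard basis.\<close>
  define G where "G z = (\<Sum>e\<in>Basis. (frechet_derivative \<phi> (at z) b \<bullet> e) * frechet_derivative F (at (\<phi> z)) e) * inverse (F (\<phi> z))" for z
  have F\<phi>: "F (\<phi> z) = r (\<phi> z)" "0 < F (\<phi> z)" "\<phi> z \<in> W" if "z \<in> V" for z
    using that W(4)[of "\<phi> z"] U(2) rs(2)[of "\<phi> z"] V_def by auto
  have eq: "G z = differential M (\<lambda>q. ln (r q)) (\<phi> z) (frechet_derivative \<phi> (at z) b)" if z: "z \<in> V" for z
  proof -
    define L where "L = frechet_derivative F (at (\<phi> z))"
    have dF: "(F has_derivative L) (at (\<phi> z))"
      unfolding L_def by (rule smooth_open_has_derivative[OF W(3) F\<phi>(3)[OF z]])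
    have lL: "linear L"
      using dF has_derivative_linear by blast
    have "((\<lambda>y. F (\<phi> y)) has_derivative (\<lambda>b. L (frechet_derivative \<phi> (at z) b))) (at z)"
      using diff_chain_at[OF chart_has_derivative[OF ch] dF] z V(3) by (auto simp: o_def)
    then have "((\<lambda>y. ln (F (\<phi> y))) has_derivative
        (\<lambda>b. L (frechet_derivative \<phi> (at z) b) * inverse (F (\<phi> z)))) (at z)"
      using F\<phi>(2)[OF z] by (auto intro!: derivative_eq_intros simp: field_simps)
    then have "((\<lambda>y. ln (r (\<phi> y))) has_derivative
        (\<lambda>b. L (frechet_derivative \<phi> (at z) b) * inverse (F (\<phi> z)))) (at z)"
      by (rule has_derivative_transform_within_open[OF _ V(1) z]) (simp add: F\<phi>)
    then have "(\<lambda>b. L (frechet_derivative \<phi> (at z) b) * inverse (F (\<phi> z)))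
       = (\<lambda>b. differential M (\<lambda>q. ln (r q)) (\<phi> z) (frechet_derivative \<phi> (at z) b))"
      by (rule has_derivative_unique) (rule chart_log_radius_has_derivative[OF r ch], use z V(3) in blast)
    then have "L (frechet_derivative \<phi> (at z) b) * inverse (F (\<phi> z))
       = differential M (\<lambda>q. ln (r q)) (\<phi> z) (frechet_derivative \<phi> (at z) b)"
      by (rule fun_cong)
    moreover have "L v = (\<Sum>e\<in>Basis. (v \<bullet> e) * L e)" for v
      using arg_cong[OF euclidean_representation[of v], of L]
      by (simp add: linear_sum[OF lL] linear_cmul[OF lL])
    ultimately show ?thesis
      unfolding G_def L_def[symmetric] by metis
  qed
  have "\<phi> differentiable (at x)"
    using chart_has_derivative[OF ch x] by (rule differentiableI)
  then have comp: "(\<lambda>z. h (\<phi> z)) differentiable (at x)" if "h differentiable (at (\<phi> x))" for h :: "complex^'N \<Rightarrow> real"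
    using differentiable_chain_at[of \<phi> x h] that by (simp add: o_def)
  have "(\<lambda>z. frechet_derivative \<phi> (at z) b) differentiable (at x)"
    by (rule smooth_open_derivative_differentiable[OF U(3,1) x])
  then have "(\<lambda>z. frechet_derivative \<phi> (at z) b \<bullet> e) differentiable (at x)" for e
    by (rule differentiable_compose[OF bounded_linear_imp_differentiable[OF bounded_linear_inner_left]])
  moreover have "(\<lambda>z. frechet_derivative F (at (\<phi> z)) e) differentiable (at x)" for e
    by (rule comp) (rule smooth_open_derivative_differentiable[OF W(3,1,2)])
  moreover have "(\<lambda>z. F (\<phi> z)) differentiable (at x)"
    by (rule comp) (rule differentiableI[OF smooth_open_has_derivative[OF W(3,2)]])
  ultimately have "G differentiable (at x)"
    unfolding G_def using F\<phi>(2)[OF V(2)]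
    by (intro differentiable_mult differentiable_sum differentiable_inverse) auto
  then obtain G' where "(G has_derivative G') (at x)"
    unfolding differentiable_def by blast
  then have "((\<lambda>z. differential M (\<lambda>q. ln (r q)) (\<phi> z) (frechet_derivative \<phi> (at z) b)) has_derivative G') (at x)"
    by (rule has_derivative_transform_within_open[OF _ V(1,2) eq])
  then show ?thesis
    by (rule differentiableI)
qed

section \<open>Contact forms and alternating forms on the link\<close>

text \<open>Reindexing by a transposition changes the sign of every summand, so the sum equals its
  own negative. Composing on the right exchanges two slots of a tensor, as needed when a one-form
  occurs twice; composing on the left exchanges two arguments, as needed when a vector occurs
  twice.\<close>

lemma sum_sign_compose_eq_zero:
  fixes T :: "(nat \<Rightarrow> nat) \<Rightarrow> 'a::field_char_0"
  assumes "finite A" "i \<in> A" "j \<in> A" "i \<noteq> j"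
  shows "(\<And>\<sigma>. \<sigma> permutes A \<Longrightarrow> T (\<sigma> \<circ> Transposition.transpose i j) = T \<sigma>) \<Longrightarrow>
      (\<Sum>\<sigma> | \<sigma> permutes A. of_int (sign \<sigma>) * T \<sigma>) = 0"
    and "(\<And>\<sigma>. \<sigma> permutes A \<Longrightarrow> T (Transposition.transpose i j \<circ> \<sigma>) = T \<sigma>) \<Longrightarrow>
      (\<Sum>\<sigma> | \<sigma> permutes A. of_int (sign \<sigma>) * T \<sigma>) = 0"
proof -
  define s where "s = (\<Sum>\<sigma> | \<sigma> permutes A. of_int (sign \<sigma>) * T \<sigma>)"
  have \<tau>: "Transposition.transpose i j permutes A"
    using assms by (simp add: permutes_swap_id)
  have sg: "sign (\<sigma> \<circ> Transposition.transpose i j) = - sign \<sigma>" "sign (Transposition.transpose i j \<circ> \<sigma>) = - sign \<sigma>"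
    if "\<sigma> permutes A" for \<sigma>
  proof -
    have "permutation \<sigma>" "permutation (Transposition.transpose i j)"
      using that \<tau> assms(1) permutation_permutes by blast+
    then show "sign (\<sigma> \<circ> Transposition.transpose i j) = - sign \<sigma>"
      "sign (Transposition.transpose i j \<circ> \<sigma>) = - sign \<sigma>"
      using assms(4) by (simp_all add: sign_compose sign_swap_id)
  qed
  have zero: "s = 0" if "s = - s"
  proof -
    have "2 * s = s + s"
      by simp
    also have "\<dots> = 0"
      by (subst (2) that) simp
    finally show ?thesis
      by simp
  qed
  show "s = 0" if T: "\<And>\<sigma>. \<sigma> permutes A \<Longrightarrow> T (\<sigma> \<circ> Transposition.transpose i j) = T \<sigma>"
  proof (rule zero)
    have "s = (\<Sum>\<sigma> | \<sigma> permutes A. of_int (sign (\<sigma> \<circ> Transposition.transpose i j)) * T (\<sigma> \<circ> Transposition.transpose i j))"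
      unfolding s_def by (rule sum_permutations_compose_right[OF \<tau>])
    also have "\<dots> = (\<Sum>\<sigma> | \<sigma> permutes A. - (of_int (sign \<sigma>) * T \<sigma>))"
      by (rule sum.cong) (auto simp: sg T)
    finally show "s = - s"
      by (simp add: s_def sum_negf)
  qed
  show "s = 0" if T: "\<And>\<sigma>. \<sigma> permutes A \<Longrightarrow> T (Transposition.transpose i j \<circ> \<sigma>) = T \<sigma>"
  proof (rule zero)
    have "s = (\<Sum>\<sigma> | \<sigma> permutes A. of_int (sign (Transposition.transpose i j \<circ> \<sigma>)) * T (Transposition.transpose i j \<circ> \<sigma>))"
      unfolding s_def by (rule setum_permutations_compose_left[OF \<tau>])
    also have "\<dots> = (\<Sum>\<sigma> | \<sigma> permutes A. - (of_int (sign \<sigma>) * T \<sigma>))"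
      by (rule sum.cong) (auto simp: sg T)
    finally show "s = - s"
      by (simp add: s_def sum_negf)
  qed
qed

text \<open>The index form of \<open>(f \<alpha> + \<lambda> \<and> \<theta>)\<^sup>n \<and> \<theta> = f\<^sup>n \<alpha>\<^sup>n \<and> \<theta>\<close>, replacing one factor at a time; the
  difference contains \<open>\<theta>\<close> twice.\<close>

lemma wedge_power_contact:
  fixes A A0 :: "nat \<Rightarrow> nat \<Rightarrow> real"
  assumes A: "\<And>i j. i < 2 * n + 1 \<Longrightarrow> j < 2 * n + 1 \<Longrightarrow> A i j = f * A0 i j + l i * \<theta> j - l j * \<theta> i"
  shows "(\<Sum>\<sigma> | \<sigma> permutes {..<2 * n + 1}. of_int (sign \<sigma>) *
            ((\<Prod>k<n. A (\<sigma> (2 * k)) (\<sigma> (2 * k + 1))) * \<theta> (\<sigma> (2 * n))))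
       = f ^ n * (\<Sum>\<sigma> | \<sigma> permutes {..<2 * n + 1}. of_int (sign \<sigma>) *
            ((\<Prod>k<n. A0 (\<sigma> (2 * k)) (\<sigma> (2 * k + 1))) * \<theta> (\<sigma> (2 * n))))"
proof -
  define I where "I = {..<2 * n + 1}"
  define F where "F m \<sigma> = (\<Prod>k<m. A (\<sigma> (2 * k)) (\<sigma> (2 * k + 1))) *
      (\<Prod>k\<in>{m..<n}. f * A0 (\<sigma> (2 * k)) (\<sigma> (2 * k + 1)))" for m :: nat and \<sigma> :: "nat \<Rightarrow> nat"
  define P where "P m = (\<Sum>\<sigma> | \<sigma> permutes I. of_int (sign \<sigma>) * (F m \<sigma> * \<theta> (\<sigma> (2 * n))))" for m
  have step: "P (Suc m) = P m" if "m < n" for m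
  proof -
    \<comment> \<open>The factors other than the \<open>m\<close>-th: they do not involve the slots
      \<open>2 * m\<close>, \<open>2 * m + 1\<close> and \<open>2 * n\<close>, so the transpositions
      used below fix them.\<close>
    define R where "R \<sigma> = (\<Prod>k<m. A (\<sigma> (2 * k)) (\<sigma> (2 * k + 1))) *
      (\<Prod>k\<in>{Suc m..<n}. f * A0 (\<sigma> (2 * k)) (\<sigma> (2 * k + 1)))" for \<sigma> :: "nat \<Rightarrow> nat"
    have R: "R (\<sigma> \<circ> Transposition.transpose i (2 * n)) = R \<sigma>" if "i = 2 * m \<or> i = 2 * m + 1" for i \<sigma>
    proof -
      have "Transposition.transpose i (2 * n) (2 * k) = 2 * k" "Transposition.transpose i (2 * n) (2 * k + 1) = 2 * k + 1"
        if "k < n" "k \<noteq> m" for k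
        using that \<open>i = 2 * m \<or> i = 2 * m + 1\<close> by (auto intro!: transpose_apply_other; presburger)+
      then show ?thesis
        unfolding R_def using \<open>m < n\<close>
        by (intro arg_cong2[where f = "(*)"] prod.cong refl) (auto simp del: One_nat_def)
    qed
    \<comment> \<open>The two correction terms of the \<open>m\<close>-th factor. In
      \<open>T1\<close> the form \<theta> sits in slots \<open>2 * m + 1\<close> and
      \<open>2 * n\<close>, in \<open>T2\<close> in slots \<open>2 * m\<close> and
      \<open>2 * n\<close>, so each has its own transposition.\<close>
    define T1 T2 where "T1 \<sigma> = R \<sigma> * l (\<sigma> (2 * m)) * \<theta> (\<sigma> (2 * m + 1)) * \<theta> (\<sigma> (2 * n))"
      and "T2 \<sigma> = R \<sigma> * l (\<sigma> (2 * m + 1)) * \<theta> (\<sigma> (2 * m)) * \<theta> (\<sigma> (2 * n))" for \<sigma>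
    have I: "finite I" "2 * m \<in> I" "2 * m + 1 \<in> I" "2 * n \<in> I" "2 * m \<noteq> 2 * n" "2 * m + 1 \<noteq> 2 * n"
      using \<open>m < n\<close> by (auto simp: I_def; presburger)+
    have T1: "(\<Sum>\<sigma> | \<sigma> permutes I. of_int (sign \<sigma>) * T1 \<sigma>) = 0"
    proof (rule sum_sign_compose_eq_zero(1)[OF I(1,3,4,6)])
      show "T1 (\<sigma> \<circ> Transposition.transpose (2 * m + 1) (2 * n)) = T1 \<sigma>" for \<sigma>
        unfolding T1_def using R[of "2 * m + 1" \<sigma>] I(5) by (simp add: transpose_apply_other)
    qed
    have T2: "(\<Sum>\<sigma> | \<sigma> permutes I. of_int (sign \<sigma>) * T2 \<sigma>) = 0"
    proof (rule sum_sign_compose_eq_zero(1)[OF I(1,2,4,5)])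
      show "T2 (\<sigma> \<circ> Transposition.transpose (2 * m) (2 * n)) = T2 \<sigma>" for \<sigma>
        unfolding T2_def using R[of "2 * m" \<sigma>] I(6) by (simp add: transpose_apply_other)
    qed
    have Fs: "F (Suc m) \<sigma> * \<theta> (\<sigma> (2 * n)) = F m \<sigma> * \<theta> (\<sigma> (2 * n)) + T1 \<sigma> - T2 \<sigma>" if "\<sigma> permutes I" for \<sigma>
    proof -
      have \<sigma>: "\<sigma> (2 * m) < 2 * n + 1" "\<sigma> (2 * m + 1) < 2 * n + 1"
        using permutes_in_image[OF that] I(2,3) unfolding I_def by (meson lessThan_iff)+
      have "{m..<n} = insert m {Suc m..<n}"
        using \<open>m < n\<close> by auto
      then have e0: "F m \<sigma> = R \<sigma> * (f * A0 (\<sigma> (2 * m)) (\<sigma> (2 * m + 1)))"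
        unfolding F_def R_def by simp
      have e1: "F (Suc m) \<sigma> = R \<sigma> * A (\<sigma> (2 * m)) (\<sigma> (2 * m + 1))"
        unfolding F_def R_def by simp
      show ?thesis
        unfolding T1_def T2_def e0 e1 A[OF \<sigma>] by (simp add: algebra_simps)
    qed
    have "P (Suc m) = P m + (\<Sum>\<sigma> | \<sigma> permutes I. of_int (sign \<sigma>) * T1 \<sigma>)
        - (\<Sum>\<sigma> | \<sigma> permutes I. of_int (sign \<sigma>) * T2 \<sigma>)"
      unfolding P_def sum.distrib[symmetric] sum_subtractf[symmetric]
      by (intro sum.cong refl) (subst Fs, simp, simp add: algebra_simps)
    then show ?thesis
      using T1 T2 by simp
  qed
  have "P m = P 0" if "m \<le> n" for m
    using that
  proof (induction m)
    case (Suc m)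
    then show ?case
      using step[of m] by simp
  qed simp
  from this[OF order_refl] have "P n = P 0" .
  moreover have "F n \<sigma> = (\<Prod>k<n. A (\<sigma> (2 * k)) (\<sigma> (2 * k + 1)))" for \<sigma>
    unfolding F_def by simp
  moreover have "F 0 \<sigma> = f ^ n * (\<Prod>k<n. A0 (\<sigma> (2 * k)) (\<sigma> (2 * k + 1)))" for \<sigma>
    unfolding F_def by (simp add: prod.distrib lessThan_atLeast0)
  ultimately show ?thesis
    unfolding P_def I_def sum_distrib_left by (simp only: ac_simps)
qed

lemma tensor_list_replicate:
  "tensor_list (replicate n (2, a) @ [(1, b)]) v
   = (\<Prod>k<n. a (\<lambda>i. v (i + 2 * k))) * b (\<lambda>i. v (i + 2 * n))"
proof (induction n arbitrary: v)
  case (Suc n)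
  have "tensor_list (replicate (Suc n) (2, a) @ [(1, b)]) v
      = a v * tensor_list (replicate n (2, a) @ [(1, b)]) (\<lambda>i. v (i + 2))"
    by simp
  also have "\<dots> = a v * ((\<Prod>k<n. a (\<lambda>i. v (i + 2 * k + 2))) * b (\<lambda>i. v (i + 2 * n + 2)))"
    by (simp only: Suc.IH)
  also have "\<dots> = (\<Prod>k<Suc n. a (\<lambda>i. v (i + 2 * k))) * b (\<lambda>i. v (i + 2 * Suc n))"
    by (simp add: prod.lessThan_Suc_shift ac_simps del: prod.lessThan_Suc)
  finally show ?case .
qed simp

lemma ext_deriv_one_form:
  "ext_deriv (D :: 'd::finite itself) M 1 (\<lambda>q w. \<omega> q (w 0)) p v =
     (let (U, \<phi>) = (SOME (U, \<phi>). chart M U (\<phi>::complex^'d \<Rightarrow> complex^'N) \<and> p \<in> \<phi> ` U);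
          x = inv_into U \<phi> p;
          a = (\<lambda>i. inv (frechet_derivative \<phi> (at x)) (v i))
      in frechet_derivative (\<lambda>z. \<omega> (\<phi> z) (frechet_derivative \<phi> (at z) (a 1))) (at x) (a 0)
         - frechet_derivative (\<lambda>z. \<omega> (\<phi> z) (frechet_derivative \<phi> (at z) (a 0))) (at x) (a 1))"
  unfolding ext_deriv_def Let_def by (simp split: prod.split)

text \<open>The denominator collects one \<open>fact 2\<close> for each d\<eta> and a
  \<open>fact 1\<close> for \<eta>. As d\<eta> sees only two arguments, it is replaced by its matrix
  of values on pairs of vectors, the shape handled by \<open>wedge_power_contact\<close>.\<close>

lemma contact_volume_sum:
  "contact_volume D M n \<eta> p v =
     (\<Sum>\<sigma> | \<sigma> permutes {..<2 * n + 1}. of_int (sign \<sigma>) *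
        ((\<Prod>k<n. ext_deriv D M 1 (\<lambda>q w. \<eta> q (w 0)) p (pair (v (\<sigma> (2 * k))) (v (\<sigma> (2 * k + 1)))))
          * \<eta> p (v (\<sigma> (2 * n))))) / 2 ^ n"
proof -
  define a where "a = ext_deriv D M 1 (\<lambda>q w. \<eta> q (w 0)) p"
  have a: "a w = a (pair (w 0) (w 1))" for w
    unfolding a_def ext_deriv_one_form Let_def by (simp split: prod.split)
  have "sum_list (map fst (replicate n (2, a) @ [(1, \<lambda>w. \<eta> p (w 0))])) = 2 * n + 1"
    by (simp add: sum_list_replicate)
  moreover have "prod_list (map (\<lambda>b. fact (fst b)) (replicate n (2, a) @ [(1, \<lambda>w. \<eta> p (w 0))])) = (2::real) ^ n"
    by (simp add: prod_list_replicate)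
  moreover have "tensor_list (replicate n (2, a) @ [(1, \<lambda>w. \<eta> p (w 0))]) (v \<circ> \<sigma>)
      = (\<Prod>k<n. a (pair (v (\<sigma> (2 * k))) (v (\<sigma> (2 * k + 1))))) * \<eta> p (v (\<sigma> (2 * n)))" for \<sigma>
  proof -
    have "a (\<lambda>i. (v \<circ> \<sigma>) (i + 2 * k)) = a (pair (v (\<sigma> (2 * k))) (v (\<sigma> (2 * k + 1))))" for k
      using a[of "\<lambda>i. (v \<circ> \<sigma>) (i + 2 * k)"] by (simp cong: if_cong)
    then show ?thesis
      unfolding tensor_list_replicate by simp
  qed
  ultimately show ?thesis
    unfolding contact_volume_def wedge_list_def a_def by simp
qed

text \<open>On the link both contact forms are proportional, which gives a relation between first
  derivatives in a chart; differentiating it along a curve in the link yields \<open>d\<eta> = f d\<eta>\<^sub>0 + \<lambda> \<and> \<eta>\<^sub>0\<close>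
  on vectors tangent to the link.\<close>

lemma ext_deriv_contact_form_link:
  fixes M :: "(complex^'N::finite) set" and D :: "'d::finite itself"
  assumes r0: "radius_function D M act \<xi>0 r0" and r: "radius_function D M act \<xi> r"
    and S: "unit_level M r = unit_level M r0" and p: "p \<in> unit_level M r0"
    and ch: "\<exists>U (\<phi>::complex^'d \<Rightarrow> complex^'N). chart M U \<phi> \<and> p \<in> \<phi> ` U"
    and f: "f = differential M (\<lambda>q. ln (r q)) p (euler_field D M r0 p)"
  obtains l where "\<And>u w. u \<in> tangent_space (unit_level M r0) p \<Longrightarrow> w \<in> tangent_space (unit_level M r0) p \<Longrightarrow>
     ext_deriv D M 1 (\<lambda>q v. contact_form M r q (v 0)) p (pair u w)
     = f * ext_deriv D M 1 (\<lambda>q v. contact_form M r0 q (v 0)) p (pair u w)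
       + l u * contact_form M r0 p w - l w * contact_form M r0 p u"
proof -
  \<comment> \<open>The chart chosen in \<open>ext_deriv\<close> depends on \<open>M\<close> and
    \<open>p\<close> alone, so both exterior derivatives are computed in the same chart.\<close>
  obtain U \<phi> where SOME_eq: "(SOME (U, \<phi>). chart M U (\<phi>::complex^'d \<Rightarrow> complex^'N) \<and> p \<in> \<phi> ` U) = (U, \<phi>)"
    by (cases "SOME (U, \<phi>). chart M U (\<phi>::complex^'d \<Rightarrow> complex^'N) \<and> p \<in> \<phi> ` U")
  have "case (U, \<phi>) of (U, \<phi>) \<Rightarrow> chart M U (\<phi>::complex^'d \<Rightarrow> complex^'N) \<and> p \<in> \<phi> ` U"
    unfolding SOME_eq[symmetric] by (rule someI_ex) (use ch in auto)
  then have c: "chart M U \<phi>" and pU: "p \<in> \<phi> ` U"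
    by auto
  have U: "open U" "\<phi> ` U \<subseteq> M"
    using c openin_imp_subset unfolding chart_def by blast+
  define x where "x = inv_into U \<phi> p"
  have x: "x \<in> U" "\<phi> x = p"
    using pU unfolding x_def by (rule inv_into_into, rule f_inv_into_f)
  define d\<phi> where "d\<phi> z = frechet_derivative \<phi> (at z)" for z
  have d\<phi>_cs: "d\<phi> z (c *s b) = c *s d\<phi> z b" if "z \<in> U" for z c b
    unfolding d\<phi>_def using chart_derivative_complex_linear[OF c that] .
  define K where "K \<rho> z b = differential M (\<lambda>q. ln (\<rho> q)) (\<phi> z) (d\<phi> z b)"
    for \<rho> :: "complex^'N \<Rightarrow> real" and z b
  define K' where "K' \<rho> b = frechet_derivative (\<lambda>z. K \<rho> z b) (at x)" for \<rho> b
  define good where "good \<rho> \<longleftrightarrow> (\<exists>\<zeta>. radius_function D M act \<zeta> \<rho>)" for \<rho>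
  have good: "good r" "good r0"
    using r r0 unfolding good_def by blast+
  have K': "((\<lambda>z. K \<rho> z b) has_derivative K' \<rho> b) (at x)" if "good \<rho>" for \<rho> b
    using that chart_log_radius_derivative_differentiable[OF _ c x(1)] frechet_derivative_works
    unfolding good_def K_def K'_def d\<phi>_def by blast
  define A where "A v = inv (d\<phi> x) v" for v
  have injd: "inj (d\<phi> x)"
    using c x(1) unfolding chart_def d\<phi>_def by simp
  have ext: "ext_deriv D M 1 (\<lambda>q v. contact_form M \<rho> q (v 0)) p (pair u w)
      = K' \<rho> (\<i> *s A u) (A w) - K' \<rho> (\<i> *s A w) (A u)" if "good \<rho>" for \<rho> u w
  proof -
    have "frechet_derivative (\<lambda>z. contact_form M \<rho> (\<phi> z) (d\<phi> z b)) (at x) = (\<lambda>a. - K' \<rho> (\<i> *s b) a)" for b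
    proof -
      have "((\<lambda>z. - K \<rho> z (\<i> *s b)) has_derivative (\<lambda>a. - K' \<rho> (\<i> *s b) a)) (at x)"
        by (rule has_derivative_minus[OF K'[OF that]])
      then have "((\<lambda>z. contact_form M \<rho> (\<phi> z) (d\<phi> z b)) has_derivative (\<lambda>a. - K' \<rho> (\<i> *s b) a)) (at x)"
        by (rule has_derivative_transform_within_open[OF _ U(1) x(1)])
           (simp add: contact_form_def K_def d\<phi>_cs)
      then show ?thesis
        by (rule frechet_derivative_at[symmetric])
    qed
    then show ?thesis
      unfolding ext_deriv_one_form SOME_eq Let_def
      by (simp add: x_def[symmetric] d\<phi>_def[symmetric] A_def)
  qed
  have pM: "p \<in> M"
    using p unfolding unit_level_def by blast
  define E where "E = A (euler_field D M r0 p)"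
  have "euler_field D M r0 p \<in> range (d\<phi> x)"
    using euler_field_tangent[OF r0 pM] tangent_space_chart[OF c x(1)] unfolding x(2) d\<phi>_def by blast
  then have "d\<phi> x E = euler_field D M r0 p"
    unfolding E_def A_def by (rule f_inv_into_f)
  then have KE: "K r0 x E = 1" "K r x E = f"
    using log_radius_euler_field[OF r0 pM] f unfolding K_def x(2) by simp_all
  \<comment> \<open>Multiplied out, the proportionality no longer mentions the factor at
    \<open>z\<close>, whose differentiability would otherwise have to be established.\<close>
  have cross: "K r z b * K r0 z e = K r z e * K r0 z b" if "z \<in> U" "\<phi> z \<in> unit_level M r0" for z b e
  proof -
    have T: "tangent_space M (\<phi> z) = range (d\<phi> z)" "subspace (tangent_space M (\<phi> z))"
      unfolding d\<phi>_def by (rule tangent_space_chart[OF c that(1)])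
        (rule subspace_tangent_space_chart(1)[OF c imageI[OF that(1)]])
    have "K r z b' = differential M (\<lambda>q. ln (r q)) (\<phi> z) (euler_field D M r0 (\<phi> z)) * K r0 z b'" for b'
      unfolding K_def by (rule log_radius_proportional[OF r0 r S that(2) T(2)]) (simp add: T(1))
    then show ?thesis
      by simp
  qed
  have Kx: "K r x b = f * K r0 x b" for b
    using cross[of x b E] x p KE by simp
  \<comment> \<open>The differentiated relation with \<open>b = E\<close>, where
    \<open>K r0 x E = 1\<close>, identifies \<mu> as the derivative of the proportionality factor
    along the link.\<close>
  define \<mu> where "\<mu> a = K' r E a - f * K' r0 E a" for a
  \<comment> \<open>Only the direction of differentiation has to be tangent to the link;
    \<open>b\<close> stays arbitrary because it will be \<open>\<i> *s A u\<close>, which need not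
    correspond to a vector tangent to the link.\<close>
  have key: "K' r b (A v) = f * K' r0 b (A v) + K r0 x b * \<mu> (A v)"
    if "v \<in> tangent_space (unit_level M r0) p" for v b
  proof -
    obtain \<gamma> :: "real \<Rightarrow> complex^'N" where \<gamma>: "range \<gamma> \<subseteq> unit_level M r0" "\<gamma> 0 = \<phi> x" "(\<gamma> has_vector_derivative v) (at 0)"
      using \<open>v \<in> tangent_space (unit_level M r0) p\<close> unfolding tangent_space_def x(2) by blast
    have "range \<gamma> \<subseteq> M"
      using \<gamma>(1) unfolding unit_level_def by blast
    then obtain c' a where c': "c' 0 = x" "range c' \<subseteq> U" "(c' has_vector_derivative a) (at 0)"
      "d\<phi> x a = v" "\<forall>\<^sub>F t in at 0. \<phi> (c' t) = \<gamma> t"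
      using chart_lift_curve[OF c x(1) \<gamma>(2) _ \<gamma>(3)] unfolding d\<phi>_def by blast
    have Av: "A v = a"
      unfolding A_def using c'(4) inv_f_f[OF injd] by auto
    have deriv: "((\<lambda>t. K \<rho> (c' t) b) has_real_derivative K' \<rho> b a) (at 0)" if "good \<rho>" for \<rho> b
      using has_derivative_along_curve[of "\<lambda>z. K \<rho> z b" "K' \<rho> b" c' UNIV a] K'[OF that] c'(1,3)
      by (simp add: has_real_derivative_iff_has_vector_derivative)
    define h where "h t = K r (c' t) b * K r0 (c' t) E - K r (c' t) E * K r0 (c' t) b" for t
    have "(h has_real_derivative (K' r b a * K r0 x E + K' r0 E a * K r x b)
             - (K' r E a * K r0 x b + K' r0 b a * K r x E)) (at 0)"
      unfolding h_def by (auto intro!: derivative_eq_intros deriv good simp: c'(1))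
    moreover have "(h has_real_derivative 0) (at 0)"
    proof -
      have ev: "\<forall>\<^sub>F t in at 0. 0 = h t"
        using c'(5)
      proof eventually_elim
        case (elim t)
        have "c' t \<in> U" "\<phi> (c' t) \<in> unit_level M r0"
          using c'(2) \<gamma>(1) elim by auto
        from cross[OF this] show ?case
          by (simp add: h_def)
      qed
      have "h 0 = 0"
        using cross[of x b E] x p by (simp add: h_def c'(1))
      have "((\<lambda>t. 0) has_vector_derivative 0) (at (0::real))"
        by (rule has_vector_derivative_const)
      then have "(h has_vector_derivative 0) (at 0)"
        unfolding has_vector_derivative_def
        by (rule has_derivative_transform_eventually[OF _ ev]) (use \<open>h 0 = 0\<close> in auto)
      then show ?thesis
        by (simp add: has_real_derivative_iff_has_vector_derivative)
    qed
    ultimately have "(K' r b a * K r0 x E + K' r0 E a * K r x b)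
             - (K' r E a * K r0 x b + K' r0 b a * K r x E) = 0"
      by (rule DERIV_unique)
    then show ?thesis
      unfolding \<mu>_def Av KE Kx by (simp add: algebra_simps)
  qed
  have K0: "K r0 x (\<i> *s A v) = - contact_form M r0 p v" if "v \<in> tangent_space (unit_level M r0) p" for v
  proof -
    have "v \<in> tangent_space M p"
      using that tangent_space_mono[of "unit_level M r0" M] unfolding unit_level_def by blast
    then have "v \<in> range (d\<phi> x)"
      using tangent_space_chart[OF c x(1)] unfolding d\<phi>_def x(2) by blast
    then have "d\<phi> x (A v) = v"
      unfolding A_def by (rule f_inv_into_f)
    then show ?thesis
      unfolding K_def contact_form_def x(2) by (simp add: d\<phi>_cs[OF x(1)])
  qed
  show ?thesis
  proof (rule that[of "\<lambda>v. \<mu> (A v)"])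
    fix u w assume u: "u \<in> tangent_space (unit_level M r0) p" and w: "w \<in> tangent_space (unit_level M r0) p"
    show "ext_deriv D M 1 (\<lambda>q v. contact_form M r q (v 0)) p (pair u w)
     = f * ext_deriv D M 1 (\<lambda>q v. contact_form M r0 q (v 0)) p (pair u w)
       + \<mu> (A u) * contact_form M r0 p w - \<mu> (A w) * contact_form M r0 p u"
      unfolding ext[OF good(1)] ext[OF good(2)] key[OF u] key[OF w] K0[OF u] K0[OF w]
      by (simp add: algebra_simps)
  qed
qed

section \<open>Alternating forms on too few dimensions\<close>

lemma alternating_on_cong:
  "alternating_on sc V k a \<Longrightarrow> (\<And>i. i < k \<Longrightarrow> v i = w i) \<Longrightarrow> a v = a w"
  unfolding alternating_on_def by blast

lemma alternating_on_linear:
  "alternating_on sc V k a \<Longrightarrow> (\<And>i. i < k \<Longrightarrow> v i \<in> V) \<Longrightarrow> i < k \<Longrightarrow> x \<in> V \<Longrightarrow> y \<in> V \<Longrightarrow>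
   a (v(i := sc c x + y)) = c * a (v(i := x)) + a (v(i := y))"
  unfolding alternating_on_def by blast

lemma alternating_on_eq_zero:
  "alternating_on sc V k a \<Longrightarrow> (\<And>i. i < k \<Longrightarrow> v i \<in> V) \<Longrightarrow> i < k \<Longrightarrow> j < k \<Longrightarrow> i \<noteq> j \<Longrightarrow> v i = v j \<Longrightarrow>
   a v = 0"
  unfolding alternating_on_def by blast

text \<open>The vectors that make the form vanish when put into slot \<open>i\<close> form a
  subspace, and it contains all the other arguments.\<close>

lemma alternating_on_span_eq_zero:
  assumes a: "alternating_on (*\<^sub>R) V k a" and V: "subspace V" and v: "\<And>j. j < k \<Longrightarrow> v j \<in> V"
    and i: "i < k" "v i \<in> span (v ` ({..<k} - {i}))"
  shows "a v = 0"
proof -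
  define Z where "Z = {x \<in> V. a (v(i := x)) = 0}"
  have lin: "a (v(i := c *\<^sub>R x + y)) = c * a (v(i := x)) + a (v(i := y))" if "x \<in> V" "y \<in> V" for c x y
    by (rule alternating_on_linear[OF a v i(1) that])
  have zero: "a (v(i := 0)) = 0"
    using lin[of 0 0 1] subspace_0[OF V] by simp
  have "subspace Z"
  proof (rule subspaceI)
    show "0 \<in> Z"
      using zero subspace_0[OF V] by (simp add: Z_def)
    show "x + y \<in> Z" if "x \<in> Z" "y \<in> Z" for x y
      using lin[of x y 1] that subspace_add[OF V] by (simp add: Z_def)
    show "c *\<^sub>R x \<in> Z" if "x \<in> Z" for c x
      using lin[of x 0 c] that zero subspace_0[OF V] subspace_scale[OF V] by (simp add: Z_def)
  qed
  moreover have "v ` ({..<k} - {i}) \<subseteq> Z"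
  proof (rule image_subsetI)
    fix j assume j: "j \<in> {..<k} - {i}"
    have "a (v(i := v j)) = 0"
      by (rule alternating_on_eq_zero[OF a, where i = i and j = j]) (use j i v in auto)
    then show "v j \<in> Z"
      using j v by (simp add: Z_def)
  qed
  ultimately have "span (v ` ({..<k} - {i})) \<subseteq> Z"
    by (intro span_minimal)
  then have "v i \<in> Z"
    using i(2) by blast
  then show ?thesis
    by (simp add: Z_def)
qed

text \<open>Either two arguments coincide, or \<open>k\<close> distinct vectors in a set of
  dimension below \<open>k\<close> are dependent. In the application \<open>V\<close> is the tangent
  space of \<open>M\<close> and \<open>W\<close> that of the link.\<close>

lemma alternating_on_dim_eq_zero:
  fixes V :: "'a::euclidean_space set"
  assumes a: "alternating_on (*\<^sub>R) V k a" and V: "subspace V" "W \<subseteq> V" and dim: "dim W < k"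
    and v: "\<And>j. j < k \<Longrightarrow> v j \<in> W"
  shows "a v = 0"
proof (cases "inj_on v {..<k}")
  case True
  have "v ` {..<k} \<subseteq> W"
    using v by blast
  moreover have "card (v ` {..<k}) = k"
    using True by (simp add: card_image)
  ultimately have "dependent (v ` {..<k})"
    using dim independent_card_le_dim[of "v ` {..<k}" W] by linarith
  then obtain i where i: "i < k" "v i \<in> span (v ` {..<k} - {v i})"
    unfolding dependent_def by blast
  have "v ` {..<k} - {v i} = v ` ({..<k} - {i})"
    using inj_on_image_set_diff[OF True, of "{..<k}" "{i}"] i(1) by simp
  with i(2) have span: "v i \<in> span (v ` ({..<k} - {i}))"
    by simp
  show ?thesis
    by (rule alternating_on_span_eq_zero[OF a V(1) _ i(1) span]) (use v V(2) in blast)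
next
  case False
  then obtain i j where "i < k" "j < k" "i \<noteq> j" "v i = v j"
    by (auto simp: inj_on_def)
  then show ?thesis
    using alternating_on_eq_zero[OF a, of v i j] v V(2) by blast
qed

text \<open>The conjugate of \<omega> is not complex linear, so the wedge product is multilinear
  over the reals only. Linearity is checked on the tensor product \<open>T\<close>; alternation
  comes from the signed sum over permutations.\<close>

lemma alternating_on_volume_form:
  fixes s :: "complex^'N::finite \<Rightarrow> (nat \<Rightarrow> complex^'N) \<Rightarrow> complex"
  assumes root: "\<exists>\<omega>. is_root_form (tangent_space M p) CARD('d) m (s p) \<omega>"
  shows "alternating_on (*\<^sub>R) (tangent_space M p) (2 * CARD('d)) (volume_form (D :: 'd::finite itself) M m s p)"
proof -
  define d where "d = CARD('d)"
  define V where "V = tangent_space M p"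
  define \<omega> where "\<omega> = (SOME \<omega>. is_root_form V d m (s p) \<omega>)"
  have "is_root_form V d m (s p) \<omega>"
    using root unfolding \<omega>_def V_def d_def by (rule someI_ex)
  then have \<omega>: "alternating_on (*s) V d \<omega>"
    unfolding is_root_form_def by blast
  define I where "I = {..<2 * d}"
  define T where "T v = \<omega> v * cnj (\<omega> (\<lambda>i. v (i + d)))" for v
  define W where "W v = (\<Sum>\<sigma> | \<sigma> permutes I. of_int (sign \<sigma>) * T (v \<circ> \<sigma>))" for v
  define k where "k = \<i> ^ d\<^sup>2 / (fact d * fact d)"
  have vol: "volume_form D M m s p v = Re (k * W v)" for v
    unfolding volume_form_def Let_def d_def[symmetric] V_def[symmetric] \<omega>_def[symmetric]
    by (simp add: wedge_list_def W_def T_def k_def I_def mult_2)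
  have Tcong: "T v = T w" if "\<And>i. i < 2 * d \<Longrightarrow> v i = w i" for v w
    unfolding T_def using that
    by (intro arg_cong2[where f = "(*)"] arg_cong[where f = cnj] alternating_on_cong[OF \<omega>]) auto
  have scR: "c *\<^sub>R x = complex_of_real c *s x" for c and x :: "complex^'N"
    by (rule vec_eq_iff[THEN iffD2]) (simp add: scaleR_conv_of_real[where 'a = complex])
  have Tlin: "T (v(j := c *\<^sub>R x + y)) = of_real c * T (v(j := x)) + T (v(j := y))"
    if v: "\<And>i. i < 2 * d \<Longrightarrow> v i \<in> V" and j: "j < 2 * d" and xy: "x \<in> V" "y \<in> V" for v j c x y
  proof (cases "j < d")
    case True
    have "(\<lambda>i. (v(j := z)) (i + d)) = (\<lambda>i. v (i + d))" for z
      using True by (auto simp: fun_eq_iff)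
    moreover have "\<omega> (v(j := c *\<^sub>R x + y)) = of_real c * \<omega> (v(j := x)) + \<omega> (v(j := y))"
      unfolding scR by (rule alternating_on_linear[OF \<omega> _ True xy]) (simp add: v)
    ultimately show ?thesis
      unfolding T_def by (simp add: algebra_simps)
  next
    case False
    define u where "u i = v (i + d)" for i
    have "(\<lambda>i. (v(j := z)) (i + d)) = u(j - d := z)" for z
      using False by (auto simp: fun_eq_iff u_def)
    moreover have "\<omega> (v(j := z)) = \<omega> v" for z
      by (rule alternating_on_cong[OF \<omega>]) (use False in auto)
    moreover have "\<omega> (u(j - d := c *\<^sub>R x + y)) = of_real c * \<omega> (u(j - d := x)) + \<omega> (u(j - d := y))"
      unfolding scR by (rule alternating_on_linear[OF \<omega> _ _ xy]) (use False j v in \<open>auto simp: u_def\<close>)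
    ultimately show ?thesis
      unfolding T_def by (simp add: algebra_simps)
  qed
  have Wcong: "W v = W w" if "\<And>i. i < 2 * d \<Longrightarrow> v i = w i" for v w
    unfolding W_def
  proof (intro sum.cong refl arg_cong2[where f = "(*)"] Tcong)
    fix \<sigma> i assume "\<sigma> \<in> {\<sigma>. \<sigma> permutes I}" "i < 2 * d"
    then have "\<sigma> i < 2 * d"
      using permutes_in_image[of \<sigma> I i] by (simp add: I_def)
    then show "(v \<circ> \<sigma>) i = (w \<circ> \<sigma>) i"
      using that by simp
  qed
  have Wlin: "W (v(j := c *\<^sub>R x + y)) = of_real c * W (v(j := x)) + W (v(j := y))"
    if v: "\<forall>i<2 * d. v i \<in> V" and j: "j < 2 * d" and xy: "x \<in> V" "y \<in> V" for v j c x y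
  proof -
    have "T (v(j := c *\<^sub>R x + y) \<circ> \<sigma>) = of_real c * T (v(j := x) \<circ> \<sigma>) + T (v(j := y) \<circ> \<sigma>)"
      if \<sigma>: "\<sigma> permutes I" for \<sigma>
    proof -
      \<comment> \<open>Changing the \<open>j\<close>-th vector before permuting changes slot
        \<open>inv \<sigma> j\<close> after permuting.\<close>
      have "v(j := z) \<circ> \<sigma> = (v \<circ> \<sigma>)(inv \<sigma> j := z)" for z
        using permutes_inverses[OF \<sigma>] by (auto simp: fun_eq_iff)
      moreover have "inv \<sigma> j < 2 * d"
        using permutes_in_image[OF permutes_inv[OF \<sigma>], of j] j by (simp add: I_def)
      moreover have "(v \<circ> \<sigma>) i \<in> V" if "i < 2 * d" for i
        using permutes_in_image[OF \<sigma>, of i] that v by (simp add: I_def)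
      ultimately show ?thesis
        using Tlin[of "v \<circ> \<sigma>" "inv \<sigma> j" x y c] xy by simp
    qed
    then show ?thesis
      unfolding W_def sum_distrib_left sum.distrib[symmetric]
      by (intro sum.cong refl) (simp add: algebra_simps)
  qed
  have Wzero: "W v = 0" if "i < 2 * d" "j < 2 * d" "i \<noteq> j" "v i = v j" for v i j
  proof -
    have "v \<circ> Transposition.transpose i j = v"
      using that(4) by (auto simp: fun_eq_iff Transposition.transpose_def)
    then have "T (v \<circ> (Transposition.transpose i j \<circ> \<sigma>)) = T (v \<circ> \<sigma>)" for \<sigma>
      by (metis comp_assoc)
    moreover have "finite I" "i \<in> I" "j \<in> I"
      using that by (auto simp: I_def)
    ultimately show ?thesis
      unfolding W_def using that(3) by (intro sum_sign_compose_eq_zero(2)[of I i j "\<lambda>\<sigma>. T (v \<circ> \<sigma>)"])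
  qed
  show ?thesis
    unfolding alternating_on_def V_def[symmetric] d_def[symmetric]
  proof (intro conjI allI impI ballI)
    show "volume_form D M m s p v = volume_form D M m s p w" if "\<forall>i<2 * d. v i = w i" for v w
      unfolding vol using Wcong[of v w] that by simp
    fix v assume v: "\<forall>i<2 * d. v i \<in> V"
    show "volume_form D M m s p (v(i := c *\<^sub>R x + y))
        = c * volume_form D M m s p (v(i := x)) + volume_form D M m s p (v(i := y))"
      if "i < 2 * d" "x \<in> V" "y \<in> V" for i c x y
      unfolding vol Wlin[OF v that] by (simp add: algebra_simps)
    show "volume_form D M m s p v = 0" if "i < 2 * d" "j < 2 * d" "i \<noteq> j" "v i = v j" for i j
      unfolding vol Wzero[OF that] by simp
  qed
qed

text \<open>The torus fields are genuine velocities: the orbit maps are differentiable, and they stay in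
  \<open>M\<close> because the removed point is fixed.\<close>

lemma torus_field_tangent:
  fixes act :: "complex^'k::finite \<Rightarrow> complex^'N::finite \<Rightarrow> complex^'N"
  assumes act: "torus_action Y act" and pt: "pt \<in> fixed_points Y act" and p: "p \<in> Y - {pt}"
  shows "torus_field act \<zeta> p \<in> tangent_space (Y - {pt}) p"
proof -
  define \<tau> :: "real \<Rightarrow> complex^'k" where "\<tau> s = (\<chi> i. exp (\<i> * of_real (s * \<zeta> $ i)))" for s
  define \<gamma> where "\<gamma> s = act (\<tau> s) p" for s
  have \<tau>: "\<tau> s \<in> torus" for s
    by (simp add: \<tau>_def torus_def)
  have \<tau>0: "\<tau> 0 = 1"
    by (simp add: \<tau>_def vec_eq_iff)
  have act1: "\<And>t y. t \<in> torus \<Longrightarrow> y \<in> Y \<Longrightarrow> act t y \<in> Y" "\<And>y. y \<in> Y \<Longrightarrow> act 1 y = y"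
    "\<And>t t' y. t \<in> torus \<Longrightarrow> t' \<in> torus \<Longrightarrow> y \<in> Y \<Longrightarrow> act (t * t') y = act t (act t' y)"
    using act unfolding torus_action_def by blast+
  have "\<gamma> s \<in> Y - {pt}" for s
  proof -
    have "\<tau> (- s) * \<tau> s = 1"
      by (simp add: \<tau>_def vec_eq_iff flip: exp_add)
    then have "act (\<tau> (- s)) (\<gamma> s) = p"
      using act1(3)[OF \<tau> \<tau>, of p "- s" s] act1(2)[of p] p by (simp add: \<gamma>_def)
    moreover have "act (\<tau> (- s)) pt = pt"
      using pt \<tau> unfolding fixed_points_def by blast
    ultimately show ?thesis
      using act1(1)[OF \<tau>, of p s] p by (auto simp: \<gamma>_def)
  qed
  then have "range \<gamma> \<subseteq> Y - {pt}"
    by blast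
  moreover have "\<gamma> 0 = p"
    using act1(2) p by (simp add: \<gamma>_def \<tau>0)
  moreover have "\<gamma> differentiable (at 0)"
  proof -
    \<comment> \<open>These are the generators in \<open>torus_action\<close>. Differentiability at
      time 0 passes from them to the algebra by induction; the inverted coordinates are harmless
      because \<open>\<tau> 0 = 1\<close>.\<close>
    define G :: "((complex^'k) \<times> (complex^'N) \<Rightarrow> complex) set" where "G = {\<lambda>(t, y). t $ i | i. True} \<union> {\<lambda>(t, y). inverse (t $ i) | i. True}
        \<union> {\<lambda>(t, y). y $ i | i. True :: bool}"
    have \<tau>i: "(\<lambda>s. \<tau> s $ i) differentiable (at 0)" for i
    proof -
      have "(\<lambda>s. \<tau> s $ i) = (\<lambda>s. exp (s *\<^sub>R (\<i> * of_real (\<zeta> $ i))))"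
        by (simp add: \<tau>_def scaleR_conv_of_real mult.left_commute)
      then show ?thesis
        using exp_scaleR_has_vector_derivative_right[of "\<i> * of_real (\<zeta> $ i)" 0 UNIV]
        unfolding has_vector_derivative_def by (simp only: differentiableI)
    qed
    have calg: "(\<lambda>s. F (\<tau> s, p)) differentiable (at 0)" if "F \<in> calgebra G" for F
      using that
    proof induction
      case (gen F)
      then show ?case
        unfolding G_def using \<tau>i differentiable_inverse[OF \<tau>i] \<tau>0
        by auto
    qed (auto intro: differentiable_add differentiable_mult)
    have "(\<lambda>s. \<gamma> s $ j) differentiable (at 0)" for j
    proof -
      obtain F where F: "F \<in> calgebra G" "\<And>t y. t \<in> torus \<Longrightarrow> y \<in> Y \<Longrightarrow> act t y $ j = F (t, y)"
        using act unfolding torus_action_def G_def by blast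
      then have "(\<lambda>s. \<gamma> s $ j) = (\<lambda>s. F (\<tau> s, p))"
        using \<tau> p by (auto simp: \<gamma>_def)
      then show ?thesis
        using calg[OF F(1)] by simp
    qed
    then have "(\<lambda>s. \<gamma> s $ j \<bullet> b) differentiable (at 0)" for j b
      by (rule differentiable_compose[OF bounded_linear_imp_differentiable[OF bounded_linear_inner_left]])
    then show ?thesis
      unfolding differentiable_componentwise_within[of \<gamma> 0 UNIV]
      by (auto simp: Basis_vec_def inner_axis)
  qed
  then have "(\<gamma> has_vector_derivative vector_derivative \<gamma> (at 0)) (at 0)"
    using vector_derivative_works by blast
  moreover have "vector_derivative \<gamma> (at 0) = torus_field act \<zeta> p"
    unfolding torus_field_def \<gamma>_def \<tau>_def ..
  ultimately show ?thesis
    unfolding tangent_space_def by auto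
qed

section \<open>Scaling of the contact volume and of the link volume\<close>

text \<open>The \<open>n\<close> factors d\<eta> contribute \<open>f ^ n\<close> once the last
  factor is \<open>\<eta>0\<close>; pulling f out of that last factor accounts for the remaining
  power.\<close>

lemma contact_volume_link:
  fixes M :: "(complex^'N::finite) set" and D :: "'d::finite itself"
  assumes r0: "radius_function D M act \<xi>0 r0" and r: "radius_function D M act \<xi> r"
    and S: "unit_level M r = unit_level M r0" and p: "p \<in> unit_level M r0"
    and ch: "\<exists>U (\<phi>::complex^'d \<Rightarrow> complex^'N). chart M U \<phi> \<and> p \<in> \<phi> ` U"
    and f: "\<And>v. v \<in> tangent_space M p \<Longrightarrow> contact_form M r p v = f * contact_form M r0 p v"
      "f = differential M (\<lambda>q. ln (r q)) p (euler_field D M r0 p)"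
    and v: "\<And>i. i < 2 * n + 1 \<Longrightarrow> v i \<in> tangent_space (unit_level M r0) p"
  shows "contact_volume D M n (contact_form M r) p v
       = f ^ (n + 1) * contact_volume D M n (contact_form M r0) p v"
proof -
  define d\<eta> where "d\<eta> \<rho> i j = ext_deriv D M 1 (\<lambda>q w. contact_form M \<rho> q (w 0)) p (pair (v i) (v j))"
    for \<rho> i j
  obtain l where l: "\<And>u w. u \<in> tangent_space (unit_level M r0) p \<Longrightarrow> w \<in> tangent_space (unit_level M r0) p \<Longrightarrow>
     ext_deriv D M 1 (\<lambda>q v. contact_form M r q (v 0)) p (pair u w)
     = f * ext_deriv D M 1 (\<lambda>q v. contact_form M r0 q (v 0)) p (pair u w)
       + l u * contact_form M r0 p w - l w * contact_form M r0 p u"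
    using ext_deriv_contact_form_link[OF r0 r S p ch f(2)] by blast
  have W: "(\<Sum>\<sigma> | \<sigma> permutes {..<2 * n + 1}. of_int (sign \<sigma>) *
          ((\<Prod>k<n. d\<eta> r (\<sigma> (2 * k)) (\<sigma> (2 * k + 1))) * contact_form M r0 p (v (\<sigma> (2 * n)))))
      = f ^ n * (\<Sum>\<sigma> | \<sigma> permutes {..<2 * n + 1}. of_int (sign \<sigma>) *
          ((\<Prod>k<n. d\<eta> r0 (\<sigma> (2 * k)) (\<sigma> (2 * k + 1))) * contact_form M r0 p (v (\<sigma> (2 * n)))))"
  proof (rule wedge_power_contact[where \<theta> = "\<lambda>i. contact_form M r0 p (v i)"])
    show "d\<eta> r i j = f * d\<eta> r0 i j + l (v i) * contact_form M r0 p (v j) - l (v j) * contact_form M r0 p (v i)"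
      if "i < 2 * n + 1" "j < 2 * n + 1" for i j
      unfolding d\<eta>_def using l[OF v v] that by blast
  qed
  have "tangent_space (unit_level M r0) p \<subseteq> tangent_space M p"
    by (rule tangent_space_mono) (auto simp: unit_level_def)
  then have \<eta>: "contact_form M r p (v (\<sigma> (2 * n))) = f * contact_form M r0 p (v (\<sigma> (2 * n)))"
    if "\<sigma> permutes {..<2 * n + 1}" for \<sigma>
    using f(1) v permutes_in_image[OF that, of "2 * n"] by (auto simp: subset_iff)
  have "(\<Sum>\<sigma> | \<sigma> permutes {..<2 * n + 1}. of_int (sign \<sigma>) *
          ((\<Prod>k<n. d\<eta> r (\<sigma> (2 * k)) (\<sigma> (2 * k + 1))) * contact_form M r p (v (\<sigma> (2 * n)))))
      = (\<Sum>\<sigma> | \<sigma> permutes {..<2 * n + 1}. f * (of_int (sign \<sigma>) *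
          ((\<Prod>k<n. d\<eta> r (\<sigma> (2 * k)) (\<sigma> (2 * k + 1))) * contact_form M r0 p (v (\<sigma> (2 * n))))))"
    by (intro sum.cong refl) (subst \<eta>, auto)
  also have "\<dots> = f * (f ^ n * (\<Sum>\<sigma> | \<sigma> permutes {..<2 * n + 1}. of_int (sign \<sigma>) *
          ((\<Prod>k<n. d\<eta> r0 (\<sigma> (2 * k)) (\<sigma> (2 * k + 1))) * contact_form M r0 p (v (\<sigma> (2 * n))))))"
    unfolding sum_distrib_left[symmetric, of f] W ..
  finally show ?thesis
    unfolding contact_volume_sum d\<eta>_def[symmetric] by (simp only: power_add power_one_right ac_simps times_divide_eq_right)
qed

text \<open>The two Euler fields agree up to the factor \<open>c\<close> modulo vectors tangent to the link, and the
  link has too small a dimension to carry a nonzero form of top degree.\<close>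

lemma link_volume_radius:
  fixes M :: "(complex^'N::finite) set" and D :: "'d::finite itself"
  assumes r0: "radius_function D M act \<xi>0 r0" and p: "p \<in> unit_level M r0"
    and ch: "\<exists>U (\<phi>::complex^'d \<Rightarrow> complex^'N). chart M U \<phi> \<and> p \<in> \<phi> ` U"
    and dV: "alternating_on (*\<^sub>R) (tangent_space M p) (2 * CARD('d)) (dV p)"
    and E: "E p \<in> tangent_space M p" "differential M (\<lambda>q. ln (r0 q)) p (E p) = c"
    and v: "\<And>i. i < 2 * CARD('d) - 1 \<Longrightarrow> v i \<in> tangent_space (unit_level M r0) p"
  shows "link_volume E dV p v = c * link_volume (euler_field D M r0) dV p v"
proof -
  have pM: "p \<in> M"
    using p by (simp add: unit_level_def)
  define V W where "V = tangent_space M p" and "W = tangent_space (unit_level M r0) p"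
  define l0 where "l0 = differential M (\<lambda>q. ln (r0 q)) p"
  define E0 where "E0 = euler_field D M r0 p"
  have V: "subspace V" "dim V = 2 * CARD('d)"
    unfolding V_def using ch subspace_tangent_space_chart(1,3) by blast+
  have lin: "linear l0"
    unfolding l0_def using radius_log_has_derivative[OF r0 pM] has_derivative_linear by blast
  have E0: "E0 \<in> V" "l0 E0 = 1"
    unfolding E0_def l0_def V_def by (rule euler_field_tangent[OF r0 pM], rule log_radius_euler_field[OF r0 pM])
  have W: "W = {v \<in> V. l0 v = 0}"
    unfolding W_def V_def l0_def by (rule tangent_space_unit_level[OF r0 p])
  have "subspace W"
    unfolding W using V(1) lin
    by (auto intro!: subspaceI simp: subspace_0 subspace_add subspace_scale linear_0 linear_add linear_cmul)
  moreover have "W \<subseteq> V" "E0 \<notin> W"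
    using E0(2) by (auto simp: W)
  ultimately have "span W \<subset> span V"
    using V(1) E0(1) by (metis psubsetI span_eq_iff)
  then have dimW: "dim W < 2 * CARD('d)"
    using dim_psubset V(2) by metis
  define F where "F = E p - c *\<^sub>R E0"
  have F: "F \<in> W"
    unfolding W F_def using V(1) E E0
    by (auto simp: V_def[symmetric] l0_def[symmetric] subspace_diff subspace_scale linear_diff[OF lin] linear_cmul[OF lin])
  have vW: "(case_nat F v) i \<in> W" if "i < 2 * CARD('d)" for i
    using F v that by (cases i) (auto simp: W_def)
  have WV: "W \<subseteq> V"
    unfolding W by blast
  have "dV p (case_nat F v) = 0"
    by (rule alternating_on_dim_eq_zero[OF dV[folded V_def] V(1) WV dimW vW])
  moreover have "(case_nat F v)(0 := x) = case_nat x v" for x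
    by (auto simp: fun_eq_iff split: nat.split)
  moreover have "dV p ((case_nat F v)(0 := c *\<^sub>R E0 + F)) = c * dV p ((case_nat F v)(0 := E0)) + dV p ((case_nat F v)(0 := F))"
    by (rule alternating_on_linear[OF dV[folded V_def]]) (use vW F WV E0 in auto)
  moreover have "c *\<^sub>R E0 + F = E p"
    by (simp add: F_def)
  ultimately show ?thesis
    unfolding link_volume_def E0_def[symmetric] by simp
qed

section \<open>Comparison of the two equations\<close>

theorem mainTheorem3:
  fixes D :: "'d::finite itself"
    and Y Ystar S :: "(complex^'N) set"
    and pt :: "complex^'N"
    and act :: "complex^'k \<Rightarrow> complex^'N \<Rightarrow> complex^'N"
    and n m :: nat
    and s :: "complex^'N \<Rightarrow> (nat \<Rightarrow> complex^'N) \<Rightarrow> complex"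
    and dV :: "complex^'N \<Rightarrow> (nat \<Rightarrow> complex^'N) \<Rightarrow> real"
    and chi \<xi> :: "real^'k"
    and r0 r :: "complex^'N \<Rightarrow> real"
    and \<eta>0 \<eta> :: "complex^'N \<Rightarrow> complex^'N \<Rightarrow> real"
    and g g0 :: "(real^'k \<Rightarrow> real) \<Rightarrow> real"
  assumes dim: "CARD('d) = n + 1"
    and Y: "affine_variety Y" "normal_variety Y"
    and act: "torus_action Y act" "effective_action Y act" "fixed_points Y act = {pt}"
    and Ystar: "Ystar = Y - {pt}" "Ystar \<subseteq> regular_locus D Y"
    and s: "0 < m" "pluricanonical_section D (regular_locus D Y) m s"
      "nowhere_vanishing D (regular_locus D Y) s"
      "equivariant_section D (regular_locus D Y) act s"
    and dV: "dV = volume_form D Ystar m s"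
    and reeb: "chi \<in> reeb_cone Y act" "\<xi> \<in> reeb_cone Y act"
    and r0: "radius_function D Ystar act chi r0"
    and S: "S = unit_level Ystar r0"
    and r: "deformation D Ystar act r0 \<xi> r"
    and \<eta>0: "\<eta>0 = contact_form Ystar r0"
    and \<eta>: "\<eta> = contact_form Ystar r"
    and g: "\<forall>y \<in> moment_slice Y act \<xi>. 0 < g y"
    and g0: "g0 = (\<lambda>y. y \<xi> powi (- int n - 2) * g (\<lambda>\<zeta>. y \<zeta> / y \<xi>))"
  shows "(forms_eq_on S (2 * n + 1)
            (\<lambda>p v. g (contact_value act \<eta> p) * contact_volume D Ystar n \<eta> p v)
            (link_volume (euler_field D Ystar r) dV)
          \<longleftrightarrow> forms_eq_on S (2 * n + 1)
            (\<lambda>p v. g0 (contact_value act \<eta>0 p) * contact_volume D Ystar n \<eta>0 p v)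
            (link_volume (euler_field D Ystar r0) dV))
       \<and> (forms_eq_on S (2 * n + 1)
            (contact_volume D Ystar n \<eta>)
            (link_volume (euler_field D Ystar r) dV)
          \<longleftrightarrow> forms_eq_on S (2 * n + 1)
            (\<lambda>p v. \<eta>0 p (torus_field act \<xi> p) powi (- int n - 2) * contact_volume D Ystar n \<eta>0 p v)
            (link_volume (euler_field D Ystar r0) dV))"
proof -
  have r': "radius_function D Ystar act \<xi> r" and S': "unit_level Ystar r = unit_level Ystar r0"
    using r unfolding deformation_def by auto
  have pointwise: "\<exists>c. c \<noteq> 0 \<and> \<eta>0 p (torus_field act \<xi> p) = c
      \<and> (\<forall>\<zeta>. \<eta> p (torus_field act \<zeta> p) = \<eta>0 p (torus_field act \<zeta> p) / c)
      \<and> contact_volume D Ystar n \<eta> p v = contact_volume D Ystar n \<eta>0 p v / c ^ (n + 1)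
      \<and> link_volume (euler_field D Ystar r) dV p v = c * link_volume (euler_field D Ystar r0) dV p v"
    if p: "p \<in> S" and v: "\<And>i. i < 2 * n + 1 \<Longrightarrow> v i \<in> tangent_space S p" for p v
  proof -
    have pS: "p \<in> unit_level Ystar r0" and pM: "p \<in> Ystar"
      using p unfolding S unit_level_def by auto
    have ch: "\<exists>U (\<phi>::complex^'d \<Rightarrow> complex^'N). chart Ystar U \<phi> \<and> p \<in> \<phi> ` U"
    proof -
      have "p \<in> regular_locus D Y"
        using pM Ystar(2) by blast
      then obtain U \<phi> where "chart Y U (\<phi>::complex^'d \<Rightarrow> complex^'N)" "p \<in> \<phi> ` U"
        unfolding regular_locus_def by blast
      then show ?thesis
        using chart_remove_point[of Y U \<phi> p pt] pM unfolding Ystar(1) by blast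
    qed
    have Jtan: "cJ u \<in> tangent_space Ystar p" if "u \<in> tangent_space Ystar p" for u
      using ch subspace_tangent_space_chart(2) that by blast
    have sub: "subspace (tangent_space Ystar p)"
      using ch subspace_tangent_space_chart(1) by blast
    define l l0 where "l = differential Ystar (\<lambda>q. ln (r q)) p" and "l0 = differential Ystar (\<lambda>q. ln (r0 q)) p"
    define f where "f = l (euler_field D Ystar r0 p)"
    have l_eq: "l u = f * l0 u" if "u \<in> tangent_space Ystar p" for u
      unfolding l_def l0_def f_def by (rule log_radius_proportional[OF r0 r' S' pS sub that])
    have f_eq: "f = differential Ystar (\<lambda>q. ln (r q)) p (euler_field D Ystar r0 p)"
      unfolding f_def l_def ..
    have \<eta>f: "contact_form Ystar r p u = f * contact_form Ystar r0 p u" if "u \<in> tangent_space Ystar p" for u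
      using l_eq[OF Jtan[OF that]] unfolding contact_form_def l_def l0_def by simp
    note E = euler_field_tangent[OF r' pM]
    define c where "c = l0 (euler_field D Ystar r p)"
    \<comment> \<open>The proportionality is evaluated on the Euler field of \<open>r\<close>, where
      d log r is 1.\<close>
    have fc: "f * c = 1"
      using l_eq[OF E] log_radius_euler_field[OF r' pM] unfolding c_def l_def by simp
    then have "c \<noteq> 0"
      by auto
    with fc have c: "c \<noteq> 0" "f = 1 / c"
      by (simp_all add: field_simps)
    have "linear l0"
      unfolding l0_def using radius_log_has_derivative[OF r0 pM] has_derivative_linear by blast
    \<comment> \<open>The field of \<xi> is J applied to the Euler field of \<open>r\<close>; the
      second J, from the contact form, gives minus that Euler field, and the two signs
      cancel.\<close>
    then have \<eta>c: "\<eta>0 p (torus_field act \<xi> p) = c"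
      unfolding \<eta>0 contact_form_def torus_field_eq[OF r' pM] cJ_cJ l0_def[symmetric] c_def
      by (simp add: linear_neg)
    have T: "torus_field act \<zeta> p \<in> tangent_space Ystar p" for \<zeta>
      using torus_field_tangent[OF act(1), of pt p \<zeta>] act(3) pM unfolding Ystar(1) by simp
    have "\<exists>\<omega>. is_root_form (tangent_space (regular_locus D Y) p) CARD('d) m (s p) \<omega>"
      using s(2) pM Ystar(2) unfolding pluricanonical_section_def by blast
    \<comment> \<open>The section is given on the regular locus, while \<open>dV\<close> is formed
      with tangent spaces of \<open>Ystar\<close>; the two sets agree near \<open>p\<close>, away
      from \<open>pt\<close>.\<close>
    moreover have "tangent_space (regular_locus D Y) p = tangent_space Ystar p"
    proof
      show "tangent_space (regular_locus D Y) p \<subseteq> tangent_space Ystar p"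
        by (rule tangent_space_local[of "- {pt}"]) (use pM Ystar(1) in \<open>auto simp: regular_locus_def\<close>)
      show "tangent_space Ystar p \<subseteq> tangent_space (regular_locus D Y) p"
        by (rule tangent_space_mono[OF Ystar(2)])
    qed
    ultimately have alt: "alternating_on (*\<^sub>R) (tangent_space Ystar p) (2 * CARD('d)) (dV p)"
      unfolding dV using alternating_on_volume_form by metis
    have "link_volume (euler_field D Ystar r) dV p v = c * link_volume (euler_field D Ystar r0) dV p v"
      by (rule link_volume_radius[where E = "euler_field D Ystar r" and dV = dV, OF r0 pS ch alt E]) (use v in \<open>auto simp: c_def l0_def dim S\<close>)
    moreover have "contact_volume D Ystar n \<eta> p v = f ^ (n + 1) * contact_volume D Ystar n \<eta>0 p v"
      unfolding \<eta> \<eta>0 by (rule contact_volume_link[OF r0 r' S' pS ch \<eta>f f_eq]) (use v in \<open>auto simp: S\<close>)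
    moreover have "\<eta> p (torus_field act \<zeta> p) = \<eta>0 p (torus_field act \<zeta> p) / c" for \<zeta>
      using \<eta>f[OF T] c(2) unfolding \<eta> \<eta>0 by simp
    ultimately show ?thesis
      using c(1) \<eta>c by (intro exI[of _ c]) (simp add: c(2) power_one_over field_simps)
  qed
  have scale: "a * (b / c ^ (n + 1)) = c * x \<longleftrightarrow> c powi (- int n - 2) * a * b = x" if "c \<noteq> 0" for a b c x :: real
  proof -
    have pw: "c powi (- int n - 2) = inverse (c ^ (n + 2))"
    proof -
      have "- int n - 2 = - int (n + 2)"
        by simp
      then show ?thesis
        by (simp only: power_int_minus power_int_of_nat)
    qed
    show ?thesis
      unfolding pw using that by (auto simp: field_simps)
  qed
  \<comment> \<open>With \<open>h\<close> left free, the value of \<open>g\<close> at the contact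
    form gives the weighted equivalence and \<open>h = 1\<close> the particular one.\<close>
  have eq: "h * contact_volume D Ystar n \<eta> p v = link_volume (euler_field D Ystar r) dV p v \<longleftrightarrow>
      \<eta>0 p (torus_field act \<xi> p) powi (- int n - 2) * h * contact_volume D Ystar n \<eta>0 p v
        = link_volume (euler_field D Ystar r0) dV p v"
    if "p \<in> S" "\<forall>i<2 * n + 1. v i \<in> tangent_space S p" for p v h
    using pointwise[of p v] that scale by auto
  have g0_eq: "g0 (contact_value act \<eta>0 p)
      = \<eta>0 p (torus_field act \<xi> p) powi (- int n - 2) * g (contact_value act \<eta> p)"
    if "p \<in> S" "\<forall>i<2 * n + 1. v i \<in> tangent_space S p" for p v
  proof -
    \<comment> \<open>Rescaling \<open>\<eta>0\<close> to take the value 1 at \<xi> recovers \<eta>,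
      so \<open>g\<close> inside \<open>g0\<close> is evaluated at the same point as in the equation
      for \<eta>.\<close>
    have "(\<lambda>\<zeta>. contact_value act \<eta>0 p \<zeta> / contact_value act \<eta>0 p \<xi>) = contact_value act \<eta> p"
      using pointwise[of p v] that by (auto simp: contact_value_def)
    then show ?thesis
      unfolding g0 by (simp add: contact_value_def)
  qed
  show ?thesis
    unfolding forms_eq_on_def
  proof (intro conjI ball_cong all_cong refl)
    fix p v assume pv: "p \<in> S" "\<forall>i<2 * n + 1. v i \<in> tangent_space S p"
    show "g (contact_value act \<eta> p) * contact_volume D Ystar n \<eta> p v = link_volume (euler_field D Ystar r) dV p v \<longleftrightarrow>
      g0 (contact_value act \<eta>0 p) * contact_volume D Ystar n \<eta>0 p v = link_volume (euler_field D Ystar r0) dV p v"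
      unfolding g0_eq[OF pv] by (rule eq[OF pv])
    show "contact_volume D Ystar n \<eta> p v = link_volume (euler_field D Ystar r) dV p v \<longleftrightarrow>
      \<eta>0 p (torus_field act \<xi> p) powi (- int n - 2) * contact_volume D Ystar n \<eta>0 p v
        = link_volume (euler_field D Ystar r0) dV p v"
      using eq[OF pv, of 1] by simp
  qed
qed

end
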